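(* Let $F$ be a finite simple graph with $e(F)>0$ and no isolated vertices. (1) A possibly infinite family of $F$-coloured finite graphs is $F$-abundant if and only if it contains an $F$-abundant member. (2) A possibly infinite family of finite graphs is $F$-abundant if and only if it contains an $F$-abundant member.
   Context: All graphs are finite and simple; $v(H)=|V(H)|$, $e(H)=|E(H)|$. A vertex is isolated if it lies in no edge. A homomorphism $H\to G$ is an edge-preserving map $V(H)\to V(G)$; an embedding is an injective homomorphism. $\mathrm{Emb}(H,G)$ is the number of embeddings of $H$ into $G$. Copies are not required to be induced; $G$ is $F$-free if there is no embedding of $F$ into $G$. An $n$-vertex graph $G$ is $\varepsilon$-far from being $F$-free if at least $\varepsilon n^2$ edges must be deleted from $G$ to make it $F$-free. An $F$-colouring of a graph $G$ is a homomorphism $\kappa_G:G\to F$; the sets $V_a(G)=\kappa_G^{-1}(a)$, $a\in V(F)$, form an $F$-partition of $G$, and a graph with such a (fixed) partition is called $F$-partite. An $F$-coloured graph is a pair $(H,\sigma)$ with $\sigma:H\to F$ an $F$-colouring. For $G$ $F$-partite, $\mathrm{Emb}_\sigma(H,G)$ is the number of embeddings $\phi:H\to G$ with $\kappa_G\circ\phi=\sigma$. An $n$-vertex $F$-partite graph $G$ is uniformly $\varepsilon$-far from being $F$-free if there is a collection $\mathcal C$ of embeddings $\psi:F\to G$ such that the sets $\psi(E(F))$, $\psi\in\mathcal C$, are pairwise disjoint, $\kappa_G\circ\psi=\mathrm{id}_{V(F)}$ for every $\psi\in\mathcal C$, and every vertex of $G$ belongs to $\psi(V(F))$ for at least $\varepsilon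 n$ members $\psi\in\mathcal C$. Abundance. - A graph $H$ is $F$-abundant if there are constants $c,C>0$ such that, for every $0<\varepsilon\le1$, there is $n_0(\varepsilon)$ for which every $\varepsilon$-far (from being $F$-free) $n$-vertex graph $G$ with $n\ge n_0(\varepsilon)$ satisfies $\mathrm{Emb}(H,G)\ge c\varepsilon^C n^{v(H)}$. - An $F$-coloured graph $(H,\sigma)$ is $F$-abundant if there are constants $c,C>0$ such that, for every $0<\varepsilon\le1$, there is $n_0(\varepsilon)$ for which every uniformly $\varepsilon$-far $n$-vertex $F$-partite graph $G$ with $n\ge n_0(\varepsilon)$ satisfies $\mathrm{Emb}_\sigma(H,G)\ge c\varepsilon^C n^{v(H)}$. - A family of graphs (respectively of $F$-coloured graphs) is $F$-abundant if there are constants $c,C>0$ such that, for every $0<\varepsilon\le1$, there is $n_0(\varepsilon)$ for which every $\varepsilon$-far $n$-vertex graph (respectively uniformly $\varepsilon$-far $n$-vertex $F$-partite graph) $G$ with $n\ge n_0(\varepsilon)$ admits some member $H$ (respectively $(H,\sigma)$) of the family, which may depend on $G$ and $\varepsilon$, with $\mathrm{Emb}(H,G)\ge c\varepsilon^C n^{v(H)}$ (respectively $\mathrm{Emb}_\sigma(H,G)\ge c\varepsilon^C n^{v(H)}$). *)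

theory Defs
  imports Complex_Main "HOL-Library.FuncSet" "HOL-Library.Disjoint_Sets"
begin

datatype 'a sgraph = SGraph (verts: "'a set") (edges: "'a set set")

definition simple_graph :: "'a sgraph \<Rightarrow> bool" where
  "simple_graph G \<longleftrightarrow> finite (verts G) \<and> (\<forall>e\<in>edges G. e \<subseteq> verts G \<and> card e = 2)"

definition isolated :: "'a sgraph \<Rightarrow> 'a \<Rightarrow> bool" where
  "isolated G v \<longleftrightarrow> v \<in> verts G \<and> (\<forall>e\<in>edges G. v \<notin> e)"

text \<open>Edges have exactly two elements, so in the next definition the two ends of an edge of the
  source are necessarily mapped to distinct vertices.\<close>

definition graph_hom :: "'a sgraph \<Rightarrow> 'b sgraph \<Rightarrow> ('a \<Rightarrow> 'b) \<Rightarrow> bool" where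
  "graph_hom H G \<phi> \<longleftrightarrow> \<phi> \<in> verts H \<rightarrow> verts G \<and> (\<forall>e\<in>edges H. \<phi> ` e \<in> edges G)"

text \<open>Embeddings are taken to be extensional (\<open>undefined\<close> outside the vertex set), so that distinct
  elements of the set below are distinct maps on \<open>verts H\<close> and its cardinality is the number
  of embeddings.\<close>

definition embeddings :: "'a sgraph \<Rightarrow> 'b sgraph \<Rightarrow> ('a \<Rightarrow> 'b) set" where
  "embeddings H G = {\<phi> \<in> extensional (verts H). graph_hom H G \<phi> \<and> inj_on \<phi> (verts H)}"

definition Emb :: "'a sgraph \<Rightarrow> 'b sgraph \<Rightarrow> nat" where
  "Emb H G = card (embeddings H G)"

definition free_of :: "'f sgraph \<Rightarrow> 'b sgraph \<Rightarrow> bool" where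
  "free_of F G \<longleftrightarrow> embeddings F G = {}"

definition far_from_free :: "'f sgraph \<Rightarrow> real \<Rightarrow> 'b sgraph \<Rightarrow> bool" where
  "far_from_free F \<epsilon> G \<longleftrightarrow>
     (\<forall>D \<subseteq> edges G. free_of F (SGraph (verts G) (edges G - D)) \<longrightarrow>
        real (card D) \<ge> \<epsilon> * real (card (verts G)) ^ 2)"

text \<open>An \<open>F\<close>-colouring is a homomorphism to \<open>F\<close>. An \<open>F\<close>-coloured graph is a pair
  \<open>(H, \<sigma>)\<close>, and an \<open>F\<close>-partite graph is likewise given as a graph \<open>G\<close> together with a colouring
  \<open>\<kappa>\<close>. The values of a colouring outside the vertex set are irrelevant.\<close>

definition coloured_graph :: "'f sgraph \<Rightarrow> 'a sgraph \<times> ('a \<Rightarrow> 'f) \<Rightarrow> bool" where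
  "coloured_graph F = (\<lambda>(H, \<sigma>). simple_graph H \<and> graph_hom H F \<sigma>)"

definition Emb_col :: "'a sgraph \<Rightarrow> ('a \<Rightarrow> 'f) \<Rightarrow> 'b sgraph \<Rightarrow> ('b \<Rightarrow> 'f) \<Rightarrow> nat" where
  "Emb_col H \<sigma> G \<kappa> = card {\<phi> \<in> embeddings H G. \<forall>v\<in>verts H. \<kappa> (\<phi> v) = \<sigma> v}"

definition uniformly_far :: "'f sgraph \<Rightarrow> real \<Rightarrow> 'b sgraph \<Rightarrow> ('b \<Rightarrow> 'f) \<Rightarrow> bool" where
  "uniformly_far F \<epsilon> G \<kappa> \<longleftrightarrow>
     (\<exists>\<C> \<subseteq> embeddings F G.
        disjoint_family_on (\<lambda>\<psi>. (\<lambda>e. \<psi> ` e) ` edges F) \<C> \<and>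
        (\<forall>\<psi>\<in>\<C>. \<forall>a\<in>verts F. \<kappa> (\<psi> a) = a) \<and>
        (\<forall>v\<in>verts G. real (card {\<psi>\<in>\<C>. v \<in> \<psi> ` verts F}) \<ge> \<epsilon> * real (card (verts G))))"

text \<open>In the notions of abundance the host graphs \<open>G\<close> have their vertices in \<open>nat\<close>; every
  finite graph is isomorphic to such a graph, and all the properties of \<open>G\<close> involved are invariant
  under isomorphism.\<close>

definition abundant :: "'f sgraph \<Rightarrow> 'h sgraph \<Rightarrow> bool" where
  "abundant F H \<longleftrightarrow>
     (\<exists>c C :: real. c > 0 \<and> C > 0 \<and>
       (\<forall>\<epsilon>::real. 0 < \<epsilon> \<and> \<epsilon> \<le> 1 \<longrightarrow>
         (\<exists>n\<^sub>0::nat. \<forall>n\<ge>n\<^sub>0. \<forall>G :: nat sgraph.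
            simple_graph G \<and> card (verts G) = n \<and> far_from_free F \<epsilon> G \<longrightarrow>
            real (Emb H G) \<ge> c * \<epsilon> powr C * real n ^ card (verts H))))"

definition abundant_col :: "'f sgraph \<Rightarrow> 'h sgraph \<times> ('h \<Rightarrow> 'f) \<Rightarrow> bool" where
  "abundant_col F = (\<lambda>(H, \<sigma>).
     (\<exists>c C :: real. c > 0 \<and> C > 0 \<and>
       (\<forall>\<epsilon>::real. 0 < \<epsilon> \<and> \<epsilon> \<le> 1 \<longrightarrow>
         (\<exists>n\<^sub>0::nat. \<forall>n\<ge>n\<^sub>0. \<forall>(G :: nat sgraph) \<kappa>.
            coloured_graph F (G, \<kappa>) \<and> card (verts G) = n \<and> uniformly_far F \<epsilon> G \<kappa> \<longrightarrow>
            real (Emb_col H \<sigma> G \<kappa>) \<ge> c * \<epsilon> powr C * real n ^ card (verts H)))))"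

definition abundant_family :: "'f sgraph \<Rightarrow> 'h sgraph set \<Rightarrow> bool" where
  "abundant_family F \<H> \<longleftrightarrow>
     (\<exists>c C :: real. c > 0 \<and> C > 0 \<and>
       (\<forall>\<epsilon>::real. 0 < \<epsilon> \<and> \<epsilon> \<le> 1 \<longrightarrow>
         (\<exists>n\<^sub>0::nat. \<forall>n\<ge>n\<^sub>0. \<forall>G :: nat sgraph.
            simple_graph G \<and> card (verts G) = n \<and> far_from_free F \<epsilon> G \<longrightarrow>
            (\<exists>H\<in>\<H>. real (Emb H G) \<ge> c * \<epsilon> powr C * real n ^ card (verts H)))))"

definition abundant_family_col :: "'f sgraph \<Rightarrow> ('h sgraph \<times> ('h \<Rightarrow> 'f)) set \<Rightarrow> bool" where
  "abundant_family_col F \<H> \<longleftrightarrow>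
     (\<exists>c C :: real. c > 0 \<and> C > 0 \<and>
       (\<forall>\<epsilon>::real. 0 < \<epsilon> \<and> \<epsilon> \<le> 1 \<longrightarrow>
         (\<exists>n\<^sub>0::nat. \<forall>n\<ge>n\<^sub>0. \<forall>(G :: nat sgraph) \<kappa>.
            coloured_graph F (G, \<kappa>) \<and> card (verts G) = n \<and> uniformly_far F \<epsilon> G \<kappa> \<longrightarrow>
            (\<exists>(H, \<sigma>)\<in>\<H>. real (Emb_col H \<sigma> G \<kappa>) \<ge> c * \<epsilon> powr C * real n ^ card (verts H)))))"

end

theory Submission
  imports Defs "HOL-Library.Nat_Bijection"
begin

text \<open>A member that is abundant makes its family abundant, so the content is the converse. If no member is
abundant, then for given constants \<open>c\<close>, \<open>C\<close> one needs a single host graph, far from being \<open>F\<close>-free, in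
which \<^emph>\<open>every\<close> member \<open>H\<close> has fewer than \<open>c \<epsilon>\<^sup>C n\<^sup>v\<close> embeddings, where \<open>v\<close> is the number of vertices of
\<open>H\<close>. For each member separately such a host exists by definition. The difficulty is to serve all
members of an infinite family with one \<open>\<epsilon>\<close> and one host. Two operations on hosts do this.

\<^item> \<^bold>\<open>Products.\<close> In a fibre product of two hosts over the colours, both the density of edge-disjoint copies
of \<open>F\<close> and the homomorphism densities multiply (\<open>host_product\<close>, \<open>hom_count_fibre_product\<close>). Replacing
the two factors by powers with comparable packing densities (\<open>balanced_powers\<close>), the product has few
homomorphisms from every graph that has few homomorphisms to one of the factors. So finitely many
graphs can be treated at once (\<open>jointly_suppressible\<close>).

\<^item> \<^bold>\<open>Disjoint copies.\<close> Passing from \<open>G\<close> to \<open>m\<close> disjoint copies of \<open>G\<close> costs a factor \<open>m\<close> in the packing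
density. A graph \<open>H\<close> with \<open>v\<close> vertices, none of them isolated, has at most \<open>v/2\<close> components, so its
homomorphism density drops by a factor of at least \<open>m\<close> to the power \<open>v/2\<close>
(\<open>hom_count_disjoint_copies\<close>). With \<open>m\<close> about \<open>1/\<epsilon>\<close> this alone settles every \<open>H\<close> that has many
non-isolated vertices, whatever \<open>H\<close> looks like.

Isolated vertices of \<open>H\<close> hardly influence the densities, and up to isomorphism only finitely many graphs
have a bounded number of vertices and no isolated ones. Hence a product that treats these finitely many
graphs, followed by disjoint copies, treats the whole family (\<open>sparse_for_family\<close>).

The coloured and the uncoloured statement are instances of one argument, in which the vertices of all
graphs are coloured by the vertices of a graph \<open>Q\<close>: in the first \<open>Q\<close> is \<open>F\<close> itself, in the second \<open>Q\<close> is
a single point with a loop. Inside the argument, distance from \<open>F\<close>-freeness is measured by the number of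
edge-disjoint copies of \<open>F\<close>, because this quantity multiplies in products in both cases. It agrees up
to constant factors in \<open>\<epsilon>\<close> with the two official notions (\<open>far_imp_packing\<close>, \<open>packing_imp_far\<close>,
\<open>uniform_packing_host\<close>, \<open>uniform_core\<close>).\<close>

section \<open>Coloured homomorphisms and packings\<close>

definition colour_homs ::
  "'a sgraph \<Rightarrow> ('a \<Rightarrow> 'c) \<Rightarrow> 'b sgraph \<Rightarrow> ('b \<Rightarrow> 'c) \<Rightarrow> ('a \<Rightarrow> 'b) set" where
  "colour_homs H \<sigma> G \<kappa> =
     {\<phi> \<in> verts H \<rightarrow>\<^sub>E verts G. (\<forall>e\<in>edges H. \<phi> ` e \<in> edges G) \<and> (\<forall>v\<in>verts H. \<kappa> (\<phi> v) = \<sigma> v)}"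

definition hom_count :: "'a sgraph \<Rightarrow> ('a \<Rightarrow> 'c) \<Rightarrow> 'b sgraph \<Rightarrow> ('b \<Rightarrow> 'c) \<Rightarrow> nat" where
  "hom_count H \<sigma> G \<kappa> = card (colour_homs H \<sigma> G \<kappa>)"

definition packing ::
  "'f sgraph \<Rightarrow> ('f \<Rightarrow> 'c) \<Rightarrow> 'b sgraph \<Rightarrow> ('b \<Rightarrow> 'c) \<Rightarrow> ('f \<Rightarrow> 'b) set \<Rightarrow> bool" where
  "packing F \<rho> G \<kappa> \<C> \<longleftrightarrow>
     \<C> \<subseteq> embeddings F G \<and>
     disjoint_family_on (\<lambda>\<psi>. (\<lambda>e. \<psi> ` e) ` edges F) \<C> \<and>
     (\<forall>\<psi>\<in>\<C>. \<forall>a\<in>verts F. \<kappa> (\<psi> a) = \<rho> a)"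

lemma packingI:
  assumes "\<And>\<psi>. \<psi> \<in> \<C> \<Longrightarrow> \<psi> \<in> embeddings F G"
    and "\<And>\<psi> \<psi>' e e'. \<psi> \<in> \<C> \<Longrightarrow> \<psi>' \<in> \<C> \<Longrightarrow> e \<in> edges F \<Longrightarrow> e' \<in> edges F \<Longrightarrow> \<psi> ` e = \<psi>' ` e' \<Longrightarrow> \<psi> = \<psi>'"
    and "\<And>\<psi> a. \<psi> \<in> \<C> \<Longrightarrow> a \<in> verts F \<Longrightarrow> \<kappa> (\<psi> a) = \<rho> a"
  shows "packing F \<rho> G \<kappa> \<C>"
proof -
  have "(\<lambda>e. \<psi> ` e) ` edges F \<inter> (\<lambda>e. \<psi>' ` e) ` edges F = {}"
    if "\<psi> \<in> \<C>" "\<psi>' \<in> \<C>" "\<psi> \<noteq> \<psi>'" for \<psi> \<psi>'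
  proof (rule ccontr)
    assume "(\<lambda>e. \<psi> ` e) ` edges F \<inter> (\<lambda>e. \<psi>' ` e) ` edges F \<noteq> {}"
    then obtain e e' where "e \<in> edges F" "e' \<in> edges F" "\<psi> ` e = \<psi>' ` e'" by auto
    with assms(2) that show False by metis
  qed
  then show ?thesis
    using assms(1,3) by (simp add: packing_def disjoint_family_on_def subset_iff)
qed

lemma packing_edge_eq:
  assumes "packing F \<rho> G \<kappa> \<C>" "\<psi> \<in> \<C>" "\<psi>' \<in> \<C>" "e \<in> edges F" "e' \<in> edges F" "\<psi> ` e = \<psi>' ` e'"
  shows "\<psi> = \<psi>'"
proof (rule ccontr)
  assume neq: "\<psi> \<noteq> \<psi>'"
  have "disjoint_family_on (\<lambda>\<psi>. (\<lambda>e. \<psi> ` e) ` edges F) \<C>"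
    using assms(1) unfolding packing_def by (elim conjE)
  then have "(\<lambda>e. \<psi> ` e) ` edges F \<inter> (\<lambda>e. \<psi>' ` e) ` edges F = {}"
    using assms(2,3) neq by (rule disjoint_family_onD)
  moreover have "\<psi>' ` e' \<in> (\<lambda>e. \<psi> ` e) ` edges F"
    unfolding assms(6)[symmetric] using assms(4) by (rule imageI)
  moreover have "\<psi>' ` e' \<in> (\<lambda>e. \<psi>' ` e) ` edges F"
    using assms(5) by (rule imageI)
  ultimately show False
    by (metis IntI empty_iff)
qed

lemma packing_embedding: "packing F \<rho> G \<kappa> \<C> \<Longrightarrow> \<psi> \<in> \<C> \<Longrightarrow> \<psi> \<in> embeddings F G"
  by (auto simp: packing_def)

lemma packing_colour:
  "packing F \<rho> G \<kappa> \<C> \<Longrightarrow> \<psi> \<in> \<C> \<Longrightarrow> a \<in> verts F \<Longrightarrow> \<kappa> (\<psi> a) = \<rho> a"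
  by (auto simp: packing_def)

lemma embeddings_finite:
  assumes "finite (verts F)" "finite (verts G)"
  shows "finite (embeddings F G)"
proof -
  have "embeddings F G \<subseteq> verts F \<rightarrow>\<^sub>E verts G"
    by (auto simp: embeddings_def graph_hom_def PiE_def)
  then show ?thesis
    using assms finite_PiE[of "verts F" "\<lambda>_. verts G"] by (meson finite_subset)
qed

lemma embeddingsD:
  assumes "\<psi> \<in> embeddings F G"
  shows "\<psi> \<in> extensional (verts F)" "\<And>a. a \<in> verts F \<Longrightarrow> \<psi> a \<in> verts G"
    "\<And>e. e \<in> edges F \<Longrightarrow> \<psi> ` e \<in> edges G" "inj_on \<psi> (verts F)"
  using assms by (auto simp: embeddings_def graph_hom_def)

lemma embeddingsI:
  assumes "\<psi> \<in> extensional (verts F)" "\<And>a. a \<in> verts F \<Longrightarrow> \<psi> a \<in> verts G"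
    "\<And>e. e \<in> edges F \<Longrightarrow> \<psi> ` e \<in> edges G" "inj_on \<psi> (verts F)"
  shows "\<psi> \<in> embeddings F G"
  using assms by (auto simp: embeddings_def graph_hom_def)

lemma simple_graphD:
  assumes "simple_graph G" "e \<in> edges G"
  shows "e \<subseteq> verts G" "card e = 2" "finite e"
  using assms by (auto simp: simple_graph_def intro: card_ge_0_finite)

lemma simple_graph_finite: "simple_graph G \<Longrightarrow> finite (verts G)"
  by (simp add: simple_graph_def)

lemma simple_graph_finite_edges: "simple_graph G \<Longrightarrow> finite (edges G)"
  by (rule finite_subset[of _ "Pow (verts G)"]) (auto simp: simple_graph_def)

lemma colour_homs_finite:
  assumes "finite (verts H)" "finite (verts G)"
  shows "finite (colour_homs H \<sigma> G \<kappa>)"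
  unfolding colour_homs_def using assms finite_PiE[of "verts H" "\<lambda>_. verts G"] by simp

lemma hom_count_le_power:
  assumes "finite (verts H)" "finite (verts G)" "\<And>q. card {v \<in> verts G. \<kappa> v = q} \<le> N"
  shows "hom_count H \<sigma> G \<kappa> \<le> N ^ card (verts H)"
proof -
  have "colour_homs H \<sigma> G \<kappa> \<subseteq> (\<Pi>\<^sub>E v\<in>verts H. {w \<in> verts G. \<kappa> w = \<sigma> v})"
    by (auto simp: colour_homs_def PiE_def Pi_def)
  then have "hom_count H \<sigma> G \<kappa> \<le> card (\<Pi>\<^sub>E v\<in>verts H. {w \<in> verts G. \<kappa> w = \<sigma> v})"
    unfolding hom_count_def using assms by (intro card_mono finite_PiE) auto
  also have "\<dots> = (\<Prod>v\<in>verts H. card {w \<in> verts G. \<kappa> w = \<sigma> v})"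
    using assms by (simp add: card_PiE)
  also have "\<dots> \<le> (\<Prod>v\<in>verts H. N)"
    using assms(3) by (intro prod_mono) auto
  also have "\<dots> = N ^ card (verts H)" by simp
  finally show ?thesis .
qed

lemma hom_count_mono:
  assumes "finite (verts H)" "finite (verts G)" "verts G' \<subseteq> verts G" "edges G' \<subseteq> edges G"
  shows "hom_count H \<sigma> G' \<kappa> \<le> hom_count H \<sigma> G \<kappa>"
  unfolding hom_count_def
proof (rule card_mono[OF colour_homs_finite])
  have "verts H \<rightarrow>\<^sub>E verts G' \<subseteq> verts H \<rightarrow>\<^sub>E verts G"
    using assms(3) by (intro PiE_mono)
  then show "colour_homs H \<sigma> G' \<kappa> \<subseteq> colour_homs H \<sigma> G \<kappa>"
    using assms(4) unfolding colour_homs_def by blast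
qed (use assms in auto)

section \<open>Isolated vertices, embeddings and homomorphisms\<close>

text \<open>Non-abundance bounds the number of embeddings of the whole graph, while the finiteness argument concerns
the graph without its isolated vertices. The lemmas of this section carry bounds from one to the other,
and from embeddings to homomorphisms, for which products are well behaved.\<close>

definition trim :: "'a sgraph \<Rightarrow> 'a sgraph" where
  "trim H = SGraph {v \<in> verts H. \<exists>e\<in>edges H. v \<in> e} (edges H)"

abbreviation isolated_verts :: "'a sgraph \<Rightarrow> 'a set" where
  "isolated_verts H \<equiv> verts H - verts (trim H)"

lemma trim_simps [simp]: "edges (trim H) = edges H" "verts (trim H) \<subseteq> verts H"
  by (auto simp: trim_def)

lemma simple_graph_trim: "simple_graph H \<Longrightarrow> simple_graph (trim H)"
  by (auto simp: simple_graph_def trim_def)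

lemma card_trim_isolated:
  assumes "finite (verts H)"
  shows "card (verts H) = card (verts (trim H)) + card (isolated_verts H)"
  using assms by (metis add_diff_cancel_left' card_Diff_subset card_mono finite_subset le_add_diff_inverse trim_simps(2))

lemma hom_count_le_trim:
  assumes H: "simple_graph H" and G: "finite (verts G)"
  shows "hom_count H \<sigma> G \<kappa> \<le> hom_count (trim H) \<sigma> G \<kappa> * card (verts G) ^ card (isolated_verts H)"
proof -
  let ?T = "verts (trim H)" and ?I = "isolated_verts H"
  let ?r = "\<lambda>\<phi>. (restrict \<phi> ?T, restrict \<phi> ?I)"
  have fin: "finite (verts H)" "finite ?T" "finite ?I"
    using H simple_graph_finite finite_subset[OF trim_simps(2)] by blast+
  have sub: "e \<subseteq> ?T" if "e \<in> edges H" for e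
    using that H simple_graphD(1) by (fastforce simp: trim_def)
  have "inj_on ?r (colour_homs H \<sigma> G \<kappa>)"
  proof (rule inj_onI)
    fix \<phi> \<phi>' assume a: "\<phi> \<in> colour_homs H \<sigma> G \<kappa>" "\<phi>' \<in> colour_homs H \<sigma> G \<kappa>" "?r \<phi> = ?r \<phi>'"
    show "\<phi> = \<phi>'"
    proof (rule extensionalityI[of _ "verts H"])
      fix v assume v: "v \<in> verts H"
      have e: "restrict \<phi> ?T v = restrict \<phi>' ?T v" "restrict \<phi> ?I v = restrict \<phi>' ?I v"
        using a(3) by (auto dest: fun_cong)
      show "\<phi> v = \<phi>' v"
        using e v by (cases "v \<in> ?T") auto
    qed (use a in \<open>auto simp: colour_homs_def PiE_def\<close>)
  qed
  moreover have "?r ` colour_homs H \<sigma> G \<kappa> \<subseteq> colour_homs (trim H) \<sigma> G \<kappa> \<times> (?I \<rightarrow>\<^sub>E verts G)"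
  proof (rule image_subsetI)
    fix \<phi> assume a: "\<phi> \<in> colour_homs H \<sigma> G \<kappa>"
    have "restrict \<phi> ?T ` e = \<phi> ` e" if "e \<in> edges H" for e
      using sub[OF that] by (intro image_cong) auto
    then show "?r \<phi> \<in> colour_homs (trim H) \<sigma> G \<kappa> \<times> (?I \<rightarrow>\<^sub>E verts G)"
      using a subsetD[OF trim_simps(2), of _ H] by (auto simp: colour_homs_def)
  qed
  ultimately have "hom_count H \<sigma> G \<kappa> \<le> card (colour_homs (trim H) \<sigma> G \<kappa> \<times> (?I \<rightarrow>\<^sub>E verts G))"
    unfolding hom_count_def using fin G
    by (intro card_inj_on_le[of ?r]) (auto intro!: finite_cartesian_product colour_homs_finite finite_PiE)
  then show ?thesis
    using fin by (simp add: hom_count_def card_cartesian_product card_PiE)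
qed

text \<open>Images of isolated vertices can be chosen freely within their colour classes. When all these classes are
large, few homomorphisms of \<open>H\<close> therefore force few homomorphisms of \<open>trim H\<close>.\<close>

lemma hom_count_trim_le:
  fixes m :: real
  assumes H: "simple_graph H" and G: "finite (verts G)" and "0 \<le> m"
    and m: "\<And>w. w \<in> verts H \<Longrightarrow> m \<le> real (card {v \<in> verts G. \<kappa> v = \<sigma> w})"
  shows "real (hom_count (trim H) \<sigma> G \<kappa>) * m ^ card (isolated_verts H) \<le> real (hom_count H \<sigma> G \<kappa>)"
proof -
  let ?T = "verts (trim H)" and ?I = "isolated_verts H"
  let ?P = "\<Pi>\<^sub>E w\<in>?I. {v \<in> verts G. \<kappa> v = \<sigma> w}"
  let ?j = "\<lambda>(\<phi>, \<tau>) v. if v \<in> ?T then \<phi> v else if v \<in> ?I then \<tau> v else undefined"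
  have fin: "finite (verts H)" "finite ?T" "finite ?I"
    using H simple_graph_finite finite_subset[OF trim_simps(2)] by blast+
  have sub: "e \<subseteq> ?T" if "e \<in> edges H" for e
    using that H simple_graphD(1) by (fastforce simp: trim_def)
  have "inj_on ?j (colour_homs (trim H) \<sigma> G \<kappa> \<times> ?P)"
  proof (rule inj_onI)
    fix x y
    assume "x \<in> colour_homs (trim H) \<sigma> G \<kappa> \<times> ?P" "y \<in> colour_homs (trim H) \<sigma> G \<kappa> \<times> ?P" "?j x = ?j y"
    then obtain \<phi> \<tau> \<phi>' \<tau>' where xy: "x = (\<phi>, \<tau>)" "y = (\<phi>', \<tau>')"
      and a: "\<phi> \<in> colour_homs (trim H) \<sigma> G \<kappa>" "\<phi>' \<in> colour_homs (trim H) \<sigma> G \<kappa>"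
        "\<tau> \<in> ?P" "\<tau>' \<in> ?P" and eq: "?j (\<phi>, \<tau>) = ?j (\<phi>', \<tau>')"
      by (cases x; cases y) blast
    have "\<phi> = \<phi>'"
    proof (rule extensionalityI[of _ ?T])
      fix v assume "v \<in> ?T" then show "\<phi> v = \<phi>' v" using fun_cong[OF eq, of v] by simp
    qed (use a in \<open>auto simp: colour_homs_def PiE_def\<close>)
    moreover have "\<tau> = \<tau>'"
    proof (rule extensionalityI[of _ ?I])
      fix v assume "v \<in> ?I" then show "\<tau> v = \<tau>' v" using fun_cong[OF eq, of v] by simp
    qed (use a in \<open>auto simp: PiE_def\<close>)
    ultimately show "x = y" by (simp add: xy)
  qed
  moreover have "?j ` (colour_homs (trim H) \<sigma> G \<kappa> \<times> ?P) \<subseteq> colour_homs H \<sigma> G \<kappa>"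
  proof (rule image_subsetI)
    fix x assume "x \<in> colour_homs (trim H) \<sigma> G \<kappa> \<times> ?P"
    then obtain \<phi> \<tau> where x: "x = (\<phi>, \<tau>)"
      and a: "\<phi> \<in> colour_homs (trim H) \<sigma> G \<kappa>" "\<tau> \<in> ?P"
      by blast
    have "?j (\<phi>, \<tau>) ` e = \<phi> ` e" if "e \<in> edges H" for e
      using sub[OF that] by (intro image_cong) auto
    then show "?j x \<in> colour_homs H \<sigma> G \<kappa>"
      unfolding x using a subsetD[OF trim_simps(2), of _ H]
      by (auto simp: colour_homs_def PiE_def Pi_def extensional_def)
  qed
  ultimately have "card (colour_homs (trim H) \<sigma> G \<kappa> \<times> ?P) \<le> hom_count H \<sigma> G \<kappa>"
    unfolding hom_count_def using fin G
    by (intro card_inj_on_le[of ?j]) (auto intro!: colour_homs_finite)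
  then have le: "real (hom_count (trim H) \<sigma> G \<kappa>) * real (card ?P) \<le> real (hom_count H \<sigma> G \<kappa>)"
    by (simp only: card_cartesian_product hom_count_def of_nat_mult[symmetric] of_nat_le_iff)
  have "m ^ card ?I = (\<Prod>w\<in>?I. m)" by simp
  also have "\<dots> \<le> (\<Prod>w\<in>?I. real (card {v \<in> verts G. \<kappa> v = \<sigma> w}))"
    using m \<open>0 \<le> m\<close> by (intro prod_mono) auto
  also have "\<dots> = real (card ?P)"
    using fin by (simp add: card_PiE)
  finally show ?thesis
    using le by (meson dual_order.trans mult_left_mono of_nat_0_le_iff)
qed

lemma noninjective_maps_le:
  assumes V: "finite V" and W: "finite W"
  shows "card {\<phi> \<in> V \<rightarrow>\<^sub>E W. \<not> inj_on \<phi> V} \<le> card V ^ 2 * card W ^ (card V - 1)"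
proof -
  let ?B = "\<lambda>(u, v). {\<phi> \<in> V \<rightarrow>\<^sub>E W. u \<noteq> v \<and> \<phi> u = \<phi> v}"
  have b: "card (?B (u, v)) \<le> card W ^ (card V - 1)" if "u \<in> V" "v \<in> V" for u v
  proof (cases "u = v")
    case False
    let ?r = "\<lambda>\<phi>. restrict \<phi> (V - {u})"
    have "inj_on ?r (?B (u, v))"
    proof (rule inj_onI, clarsimp)
      fix \<phi> \<phi>' assume a: "\<phi> \<in> V \<rightarrow>\<^sub>E W" "\<phi>' \<in> V \<rightarrow>\<^sub>E W" "\<phi> u = \<phi> v" "\<phi>' u = \<phi>' v"
        and eq: "?r \<phi> = ?r \<phi>'"
      have "\<phi> w = \<phi>' w" if "w \<in> V" "w \<noteq> u" for w using fun_cong[OF eq, of w] that by simp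
      then show "\<phi> = \<phi>'"
        using a \<open>v \<in> V\<close> False by (intro extensionalityI[of _ V]) (auto simp: PiE_def, metis)
    qed
    moreover have "?r ` ?B (u, v) \<subseteq> V - {u} \<rightarrow>\<^sub>E W"
      by (intro image_subsetI restrict_PiE_iff[THEN iffD2]) auto
    ultimately have "card (?B (u, v)) \<le> card (V - {u} \<rightarrow>\<^sub>E W)"
      using V W by (intro card_inj_on_le[of ?r]) (auto intro!: finite_PiE)
    also have "\<dots> = card W ^ (card V - 1)" using V \<open>u \<in> V\<close> by (simp add: card_PiE)
    finally show ?thesis .
  qed simp
  have "{\<phi> \<in> V \<rightarrow>\<^sub>E W. \<not> inj_on \<phi> V} \<subseteq> (\<Union>p\<in>V \<times> V. ?B p)"
    by (auto simp: inj_on_def)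
  then have "card {\<phi> \<in> V \<rightarrow>\<^sub>E W. \<not> inj_on \<phi> V} \<le> card (\<Union>p\<in>V \<times> V. ?B p)"
    using V W by (intro card_mono) (auto intro!: finite_PiE)
  also have "\<dots> \<le> (\<Sum>p\<in>V \<times> V. card (?B p))"
    using V by (intro card_UN_le) auto
  also have "\<dots> \<le> (\<Sum>p\<in>V \<times> V. card W ^ (card V - 1))"
    using b by (intro sum_mono) auto
  also have "\<dots> = card V ^ 2 * card W ^ (card V - 1)"
    by (simp add: card_cartesian_product power2_eq_square)
  finally show ?thesis .
qed

definition emb_count :: "'a sgraph \<Rightarrow> ('a \<Rightarrow> 'c) \<Rightarrow> 'b sgraph \<Rightarrow> ('b \<Rightarrow> 'c) \<Rightarrow> nat" where
  "emb_count H \<sigma> G \<kappa> = card {\<phi> \<in> colour_homs H \<sigma> G \<kappa>. inj_on \<phi> (verts H)}"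

lemma emb_count_le_hom_count:
  assumes "finite (verts H)" "finite (verts G)"
  shows "emb_count H \<sigma> G \<kappa> \<le> hom_count H \<sigma> G \<kappa>"
  unfolding emb_count_def hom_count_def using assms
  by (intro card_mono colour_homs_finite) auto

lemma hom_count_le_emb_count:
  assumes "finite (verts H)" "finite (verts G)"
  shows "hom_count H \<sigma> G \<kappa> \<le> emb_count H \<sigma> G \<kappa> + card (verts H) ^ 2 * card (verts G) ^ (card (verts H) - 1)"
proof -
  let ?M = "{\<phi> \<in> verts H \<rightarrow>\<^sub>E verts G. \<not> inj_on \<phi> (verts H)}"
  have "colour_homs H \<sigma> G \<kappa> \<subseteq> {\<phi> \<in> colour_homs H \<sigma> G \<kappa>. inj_on \<phi> (verts H)} \<union> ?M"
    by (auto simp: colour_homs_def)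
  then have "hom_count H \<sigma> G \<kappa> \<le> card ({\<phi> \<in> colour_homs H \<sigma> G \<kappa>. inj_on \<phi> (verts H)} \<union> ?M)"
    unfolding hom_count_def using assms
    by (intro card_mono) (auto intro!: finite_PiE colour_homs_finite)
  also have "\<dots> \<le> emb_count H \<sigma> G \<kappa> + card ?M"
    unfolding emb_count_def by (rule card_Un_le)
  also have "card ?M \<le> card (verts H) ^ 2 * card (verts G) ^ (card (verts H) - 1)"
    using assms by (rule noninjective_maps_le)
  finally show ?thesis by simp
qed

lemma Emb_col_eq_emb_count: "Emb_col H \<sigma> G \<kappa> = emb_count H \<sigma> G \<kappa>"
  unfolding Emb_col_def emb_count_def embeddings_def colour_homs_def graph_hom_def
  by (intro arg_cong[of _ _ card] Collect_cong) (auto simp: PiE_iff)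

lemma Emb_eq_emb_count: "Emb H G = emb_count H (\<lambda>_. ()) G (\<lambda>_. ())"
  unfolding Emb_def emb_count_def embeddings_def colour_homs_def graph_hom_def
  by (intro arg_cong[of _ _ card] Collect_cong) (auto simp: PiE_iff)

section \<open>Fibre products\<close>

text \<open>Hosts have their vertices in \<open>nat\<close>, and their powers of any order must again be of this type. Pairs of
vertices are therefore coded by natural numbers.\<close>

abbreviation pi1 :: "nat \<Rightarrow> nat" where "pi1 n \<equiv> fst (prod_decode n)"
abbreviation pi2 :: "nat \<Rightarrow> nat" where "pi2 n \<equiv> snd (prod_decode n)"

lemma pi_eqI: "pi1 m = pi1 n \<Longrightarrow> pi2 m = pi2 n \<Longrightarrow> m = n"
  by (metis prod_decode_inverse prod.collapse)

definition fibre_product ::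
  "nat sgraph \<Rightarrow> (nat \<Rightarrow> 'c) \<Rightarrow> nat sgraph \<Rightarrow> (nat \<Rightarrow> 'c) \<Rightarrow> nat sgraph" where
  "fibre_product G \<kappa> G' \<kappa>' =
     (let V = {n. pi1 n \<in> verts G \<and> pi2 n \<in> verts G' \<and> \<kappa> (pi1 n) = \<kappa>' (pi2 n)}
      in SGraph V {e. e \<subseteq> V \<and> card e = 2 \<and> pi1 ` e \<in> edges G \<and> pi2 ` e \<in> edges G'})"

lemma fibre_product_verts:
  "n \<in> verts (fibre_product G \<kappa> G' \<kappa>') \<longleftrightarrow>
     pi1 n \<in> verts G \<and> pi2 n \<in> verts G' \<and> \<kappa> (pi1 n) = \<kappa>' (pi2 n)"
  by (simp add: fibre_product_def Let_def)

lemma fibre_product_edges: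
  "e \<in> edges (fibre_product G \<kappa> G' \<kappa>') \<longleftrightarrow>
     e \<subseteq> verts (fibre_product G \<kappa> G' \<kappa>') \<and> card e = 2 \<and> pi1 ` e \<in> edges G \<and> pi2 ` e \<in> edges G'"
  by (simp add: fibre_product_def Let_def)

lemma fibre_product_class:
  "{n \<in> verts (fibre_product G \<kappa> G' \<kappa>'). \<kappa> (pi1 n) = q} =
     prod_encode ` ({v \<in> verts G. \<kappa> v = q} \<times> {v \<in> verts G'. \<kappa>' v = q})" (is "?L = ?R")
proof
  show "?L \<subseteq> ?R"
  proof
    fix n assume "n \<in> ?L"
    then show "n \<in> ?R"
      by (intro image_eqI[of _ _ "prod_decode n"]) (auto simp: fibre_product_verts mem_Times_iff)
  qed
qed (auto simp: fibre_product_verts)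

lemma simple_graph_fibre_product:
  assumes "simple_graph G" "simple_graph G'"
  shows "simple_graph (fibre_product G \<kappa> G' \<kappa>')"
proof -
  have "verts (fibre_product G \<kappa> G' \<kappa>') \<subseteq> prod_encode ` (verts G \<times> verts G')"
  proof
    fix n assume "n \<in> verts (fibre_product G \<kappa> G' \<kappa>')"
    then show "n \<in> prod_encode ` (verts G \<times> verts G')"
      by (intro image_eqI[of _ _ "prod_decode n"]) (auto simp: fibre_product_verts mem_Times_iff)
  qed
  moreover have "finite (prod_encode ` (verts G \<times> verts G'))"
    using assms by (simp add: simple_graph_finite)
  ultimately have "finite (verts (fibre_product G \<kappa> G' \<kappa>'))" by (rule finite_subset)
  then show ?thesis by (simp add: simple_graph_def fibre_product_edges)
qed

lemma hom_count_fibre_product: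
  assumes fin: "finite (verts H)" "finite (verts G)" "finite (verts G')"
    and sub: "\<And>e. e \<in> edges H \<Longrightarrow> e \<subseteq> verts H"
  shows "hom_count H \<sigma> (fibre_product G \<kappa> G' \<kappa>') (\<kappa> \<circ> pi1) \<le> hom_count H \<sigma> G \<kappa> * hom_count H \<sigma> G' \<kappa>'"
proof -
  let ?P = "fibre_product G \<kappa> G' \<kappa>'"
  let ?r = "\<lambda>\<phi>. (restrict (pi1 \<circ> \<phi>) (verts H), restrict (pi2 \<circ> \<phi>) (verts H))"
  have "inj_on ?r (colour_homs H \<sigma> ?P (\<kappa> \<circ> pi1))"
  proof (rule inj_onI)
    fix \<phi> \<phi>' assume a: "\<phi> \<in> colour_homs H \<sigma> ?P (\<kappa> \<circ> pi1)" "\<phi>' \<in> colour_homs H \<sigma> ?P (\<kappa> \<circ> pi1)"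
      and eq: "?r \<phi> = ?r \<phi>'"
    show "\<phi> = \<phi>'"
    proof (rule extensionalityI[of _ "verts H"])
      fix v assume v: "v \<in> verts H"
      have "restrict (pi1 \<circ> \<phi>) (verts H) v = restrict (pi1 \<circ> \<phi>') (verts H) v"
        "restrict (pi2 \<circ> \<phi>) (verts H) v = restrict (pi2 \<circ> \<phi>') (verts H) v"
        using eq by simp_all
      then show "\<phi> v = \<phi>' v" using v by (simp add: pi_eqI)
    qed (use a in \<open>auto simp: colour_homs_def PiE_def\<close>)
  qed
  moreover have "?r ` colour_homs H \<sigma> ?P (\<kappa> \<circ> pi1) \<subseteq> colour_homs H \<sigma> G \<kappa> \<times> colour_homs H \<sigma> G' \<kappa>'"
  proof (rule image_subsetI)
    fix \<phi> assume a: "\<phi> \<in> colour_homs H \<sigma> ?P (\<kappa> \<circ> pi1)"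
    then have v: "\<phi> v \<in> verts ?P" "\<kappa> (pi1 (\<phi> v)) = \<sigma> v" if "v \<in> verts H" for v
      using that by (auto simp: colour_homs_def)
    have im: "restrict (pi1 \<circ> \<phi>) (verts H) ` e = pi1 ` \<phi> ` e" "restrict (pi2 \<circ> \<phi>) (verts H) ` e = pi2 ` \<phi> ` e"
      if "e \<in> edges H" for e
      using sub[OF that] by (auto simp: image_iff subset_iff)
    have e: "pi1 ` \<phi> ` e \<in> edges G" "pi2 ` \<phi> ` e \<in> edges G'" if "e \<in> edges H" for e
      using a that by (auto simp: colour_homs_def fibre_product_edges)
    have "restrict (pi1 \<circ> \<phi>) (verts H) \<in> colour_homs H \<sigma> G \<kappa>"
      unfolding colour_homs_def mem_Collect_eq
    proof (intro conjI ballI)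
      show "restrict (pi1 \<circ> \<phi>) (verts H) ` e \<in> edges G" if "e \<in> edges H" for e
        unfolding im[OF that] by (rule e(1)[OF that])
    qed (use v in \<open>auto simp: fibre_product_verts\<close>)
    moreover have "restrict (pi2 \<circ> \<phi>) (verts H) \<in> colour_homs H \<sigma> G' \<kappa>'"
      unfolding colour_homs_def mem_Collect_eq
    proof (intro conjI ballI)
      show "restrict (pi2 \<circ> \<phi>) (verts H) ` e \<in> edges G'" if "e \<in> edges H" for e
        unfolding im[OF that] by (rule e(2)[OF that])
    qed (use v in \<open>auto simp: fibre_product_verts\<close>)
    ultimately show "?r \<phi> \<in> colour_homs H \<sigma> G \<kappa> \<times> colour_homs H \<sigma> G' \<kappa>'" by simp
  qed
  ultimately show ?thesis
    unfolding hom_count_def card_cartesian_product[symmetric]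
    using fin by (intro card_inj_on_le[of ?r]) (auto intro!: colour_homs_finite)
qed

text \<open>Two copies of \<open>F\<close>, one in each factor, which give the same colours to the vertices of \<open>F\<close>, form a copy
in the product. An edge of the product determines its projections, hence the two copies that it comes
from, so edge-disjointness is inherited.\<close>

lemma packing_fibre_product:
  assumes F: "simple_graph F" "edges F \<noteq> {}"
    and p: "packing F \<rho> G \<kappa> \<C>" and p': "packing F \<rho> G' \<kappa>' \<C>'"
    and fin: "finite \<C>" "finite \<C>'"
  obtains \<D> where "packing F \<rho> (fibre_product G \<kappa> G' \<kappa>') (\<kappa> \<circ> pi1) \<D>" "card \<D> = card \<C> * card \<C>'"
proof -
  let ?P = "fibre_product G \<kappa> G' \<kappa>'"
  define h where "h = (\<lambda>(\<psi>, \<psi>'). \<lambda>a\<in>verts F. prod_encode (\<psi> a, \<psi>' a :: nat))"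
  have h1: "pi1 ` h (\<psi>, \<psi>') ` e = \<psi> ` e" and h2: "pi2 ` h (\<psi>, \<psi>') ` e = \<psi>' ` e"
    if "e \<in> edges F" for e \<psi> \<psi>'
    using simple_graphD(1)[OF F(1) that] by (auto simp: h_def image_iff subset_iff)
  have inj: "x = y" if x: "x \<in> \<C> \<times> \<C>'" and y: "y \<in> \<C> \<times> \<C>'" and e: "e \<in> edges F" "e' \<in> edges F"
    and eq: "h x ` e = h y ` e'" for x y e e'
  proof -
    obtain \<psi> \<psi>' \<chi> \<chi>' where xy: "x = (\<psi>, \<psi>')" "y = (\<chi>, \<chi>')" by (cases x; cases y)
    have "\<psi> ` e = \<chi> ` e'" "\<psi>' ` e = \<chi>' ` e'"
      using arg_cong[OF eq, of "image pi1"] arg_cong[OF eq, of "image pi2"] e by (simp_all add: xy h1 h2)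
    then show ?thesis
      using packing_edge_eq[OF p _ _ e] packing_edge_eq[OF p' _ _ e] x y by (auto simp: xy)
  qed
  have emb: "h (\<psi>, \<psi>') \<in> embeddings F ?P" if "\<psi> \<in> \<C>" "\<psi>' \<in> \<C>'" for \<psi> \<psi>'
  proof (rule embeddingsI)
    note e = embeddingsD[OF packing_embedding[OF p that(1)]]
    note e' = embeddingsD[OF packing_embedding[OF p' that(2)]]
    show v: "h (\<psi>, \<psi>') a \<in> verts ?P" if "a \<in> verts F" for a
      using that e(2) e'(2) packing_colour[OF p \<open>\<psi> \<in> \<C>\<close>] packing_colour[OF p' \<open>\<psi>' \<in> \<C>'\<close>]
      by (simp add: h_def fibre_product_verts)
    show i: "inj_on (h (\<psi>, \<psi>')) (verts F)"
      using e(4) by (auto simp: h_def inj_on_def)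
    show "h (\<psi>, \<psi>') ` d \<in> edges ?P" if "d \<in> edges F" for d
    proof -
      have "card (h (\<psi>, \<psi>') ` d) = 2"
        using simple_graphD[OF F(1) that] i by (metis card_image inj_on_subset)
      then show ?thesis
        unfolding fibre_product_edges h1[OF that] h2[OF that]
        using v simple_graphD[OF F(1) that] e(3) e'(3) that by auto
    qed
  qed (simp add: h_def)
  obtain e0 where e0: "e0 \<in> edges F" using F(2) by auto
  have "packing F \<rho> ?P (\<kappa> \<circ> pi1) (h ` (\<C> \<times> \<C>'))"
  proof (rule packingI)
    show "(\<kappa> \<circ> pi1) (\<psi> a) = \<rho> a" if "\<psi> \<in> h ` (\<C> \<times> \<C>')" "a \<in> verts F" for \<psi> a
      using that packing_colour[OF p] by (auto simp: h_def)
    show "\<psi> = \<chi>" if eq: "\<psi> \<in> h ` (\<C> \<times> \<C>')" "\<chi> \<in> h ` (\<C> \<times> \<C>')" "e \<in> edges F" "e' \<in> edges F"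
      "\<psi> ` e = \<chi> ` e'" for \<psi> \<chi> e e'
    proof -
      obtain x y where "x \<in> \<C> \<times> \<C>'" "y \<in> \<C> \<times> \<C>'" "\<psi> = h x" "\<chi> = h y" using eq(1,2) by blast
      then show ?thesis using inj[of x y e e'] eq(3-5) by simp
    qed
  qed (use emb in auto)
  moreover have "card (h ` (\<C> \<times> \<C>')) = card \<C> * card \<C>'"
    using inj[OF _ _ e0 e0] by (subst card_image) (auto intro!: inj_onI simp: card_cartesian_product)
  ultimately show ?thesis by (rule that)
qed

section \<open>Hosts\<close>

text \<open>The graph \<open>Q\<close> may have loops, i.e. edges with one element. The choice \<open>Q = F\<close> gives \<open>F\<close>-partite hosts,
and a single looped point imposes no condition on hosts at all.\<close>

locale coloured_base =
  fixes F :: "'f sgraph" and Q :: "'c sgraph" and \<rho> :: "'f \<Rightarrow> 'c"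
  assumes simple_F: "simple_graph F"
    and edges_F: "edges F \<noteq> {}"
    and cover_F: "\<And>a. a \<in> verts F \<Longrightarrow> \<exists>e\<in>edges F. a \<in> e"
    and hom_\<rho>: "graph_hom F Q \<rho>"
    and surj_\<rho>: "\<rho> ` verts F = verts Q"
begin

text \<open>The reference size \<open>N\<close> bounds the colour classes instead of being the number of vertices: the number of
vertices of a fibre product depends on how the vertices are distributed over the colours, whereas the
parameters \<open>\<epsilon>\<close> and \<open>N\<close> simply multiply. Up to constant factors and powers of \<open>\<epsilon>\<close> the two sizes agree.\<close>

definition host :: "real \<Rightarrow> nat \<Rightarrow> nat sgraph \<Rightarrow> (nat \<Rightarrow> 'c) \<Rightarrow> bool" where
  "host \<epsilon> N G \<kappa> \<longleftrightarrow>
     simple_graph G \<and> graph_hom G Q \<kappa> \<and> (\<forall>q. card {v \<in> verts G. \<kappa> v = q} \<le> N) \<and>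
     (\<exists>\<C>. packing F \<rho> G \<kappa> \<C> \<and> \<epsilon> * real N ^ 2 \<le> real (card \<C>))"

lemma finite_packing: "simple_graph G \<Longrightarrow> packing F \<rho> G \<kappa> \<C> \<Longrightarrow> finite \<C>"
  using embeddings_finite[OF simple_graph_finite[OF simple_F] simple_graph_finite]
  by (auto simp: packing_def intro: finite_subset)

lemma finite_Q: "finite (verts Q)"
  using surj_\<rho> simple_graph_finite[OF simple_F] by (metis finite_imageI)

lemma edge_at:
  assumes "a \<in> verts F"
  obtains b where "b \<in> verts F" "a \<noteq> b" "{a, b} \<in> edges F"
proof -
  obtain e where e: "e \<in> edges F" "a \<in> e" using cover_F assms by blast
  then obtain x y where xy: "e = {x, y}" "x \<noteq> y"
    using simple_graphD(2)[OF simple_F] by (meson card_2_iff)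
  define b where "b = (if a = x then y else x)"
  have "e = {a, b}" "a \<noteq> b" using xy e by (auto simp: b_def)
  then show ?thesis using that e simple_graphD(1)[OF simple_F e(1)] by blast
qed

lemma card_packing_le:
  assumes p: "packing F \<rho> G \<kappa> \<C>" and G: "simple_graph G" and ab: "{a, b} \<in> edges F" "a \<noteq> b"
  shows "card \<C> \<le> card {v \<in> verts G. \<kappa> v = \<rho> a} * card {v \<in> verts G. \<kappa> v = \<rho> b}"
proof -
  have v: "a \<in> verts F" "b \<in> verts F" using simple_graphD(1)[OF simple_F ab(1)] by auto
  have "inj_on (\<lambda>\<psi>. (\<psi> a, \<psi> b)) \<C>"
  proof (rule inj_onI)
    fix \<psi> \<chi> assume "\<psi> \<in> \<C>" "\<chi> \<in> \<C>" "(\<psi> a, \<psi> b) = (\<chi> a, \<chi> b)"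
    then show "\<psi> = \<chi>" using packing_edge_eq[OF p _ _ ab(1) ab(1)] by auto
  qed
  moreover have "(\<lambda>\<psi>. (\<psi> a, \<psi> b)) ` \<C> \<subseteq> {v \<in> verts G. \<kappa> v = \<rho> a} \<times> {v \<in> verts G. \<kappa> v = \<rho> b}"
    using embeddingsD(2)[OF packing_embedding[OF p]] packing_colour[OF p] v by auto
  ultimately show ?thesis
    unfolding card_cartesian_product[symmetric] using simple_graph_finite[OF G]
    by (intro card_inj_on_le) auto
qed

text \<open>The absence of isolated vertices in \<open>F\<close> enters here: every colour is the colour of an end of
some edge \<open>ab\<close> of \<open>F\<close>, the copies in a packing are determined by the images of \<open>a\<close> and \<open>b\<close>, and there
are at most \<open>N\<close> choices for the image of \<open>b\<close>.\<close>

lemma host_class_ge: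
  assumes h: "host \<epsilon> N G \<kappa>" and q: "q \<in> verts Q"
  shows "\<epsilon> * real N \<le> real (card {v \<in> verts G. \<kappa> v = q})"
proof -
  obtain \<C> where \<C>: "packing F \<rho> G \<kappa> \<C>" "\<epsilon> * real N ^ 2 \<le> real (card \<C>)" and G: "simple_graph G"
    and N: "\<And>q. card {v \<in> verts G. \<kappa> v = q} \<le> N"
    using h by (auto simp: host_def)
  obtain a where a: "a \<in> verts F" "q = \<rho> a" using q surj_\<rho> by blast
  obtain b where b: "{a, b} \<in> edges F" "a \<noteq> b" using edge_at a by metis
  have "\<epsilon> * real N ^ 2 \<le> real (card {v \<in> verts G. \<kappa> v = q} * card {v \<in> verts G. \<kappa> v = \<rho> b})"
    using \<C>(2) card_packing_le[OF \<C>(1) G b] a(2) by (meson dual_order.trans of_nat_mono)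
  also have "\<dots> \<le> real (card {v \<in> verts G. \<kappa> v = q}) * real N"
    using N[of "\<rho> b"] by (simp add: mult_left_mono)
  finally have "(\<epsilon> * real N) * real N \<le> real (card {v \<in> verts G. \<kappa> v = q}) * real N"
    by (simp add: power2_eq_square mult.assoc)
  then show ?thesis by (cases "N = 0") auto
qed

lemma host_product:
  assumes h: "host \<epsilon> N G \<kappa>" and h': "host \<epsilon>' N' G' \<kappa>'" and "0 \<le> \<epsilon>" "0 \<le> \<epsilon>'"
  shows "host (\<epsilon> * \<epsilon>') (N * N') (fibre_product G \<kappa> G' \<kappa>') (\<kappa> \<circ> pi1)"
proof -
  let ?P = "fibre_product G \<kappa> G' \<kappa>'"
  obtain \<C> where \<C>: "packing F \<rho> G \<kappa> \<C>" "\<epsilon> * real N ^ 2 \<le> real (card \<C>)" and G: "simple_graph G" "graph_hom G Q \<kappa>"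
    and N: "\<And>q. card {v \<in> verts G. \<kappa> v = q} \<le> N"
    using h by (auto simp: host_def)
  obtain \<C>' where \<C>': "packing F \<rho> G' \<kappa>' \<C>'" "\<epsilon>' * real N' ^ 2 \<le> real (card \<C>')" and G': "simple_graph G'"
    and N': "\<And>q. card {v \<in> verts G'. \<kappa>' v = q} \<le> N'"
    using h' by (auto simp: host_def)
  obtain \<D> where \<D>: "packing F \<rho> ?P (\<kappa> \<circ> pi1) \<D>" "card \<D> = card \<C> * card \<C>'"
    using packing_fibre_product[OF simple_F edges_F \<C>(1) \<C>'(1)]
      finite_packing[OF G(1) \<C>(1)] finite_packing[OF G' \<C>'(1)] by blast
  have "(\<epsilon> * \<epsilon>') * real (N * N') ^ 2 = (\<epsilon> * real N ^ 2) * (\<epsilon>' * real N' ^ 2)"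
    by (simp add: power_mult_distrib)
  also have "\<dots> \<le> real (card \<D>)"
    unfolding \<D>(2) of_nat_mult using assms(3,4) \<C>(2) \<C>'(2) by (intro mult_mono) auto
  finally have d: "(\<epsilon> * \<epsilon>') * real (N * N') ^ 2 \<le> real (card \<D>)" .
  have c: "card {n \<in> verts ?P. (\<kappa> \<circ> pi1) n = q} \<le> N * N'" for q
    using N[of q] N'[of q]
    by (simp add: fibre_product_class card_image inj_prod_encode card_cartesian_product mult_mono)
  have "graph_hom ?P Q (\<kappa> \<circ> pi1)"
    unfolding graph_hom_def
  proof (intro conjI ballI Pi_I)
    show "(\<kappa> \<circ> pi1) n \<in> verts Q" if "n \<in> verts ?P" for n
    proof -
      have "pi1 n \<in> verts G" using that by (simp add: fibre_product_verts)
      then show ?thesis using G(2) by (auto simp: graph_hom_def)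
    qed
    show "(\<kappa> \<circ> pi1) ` e \<in> edges Q" if "e \<in> edges ?P" for e
      unfolding image_comp[symmetric] using G(2) that by (simp add: graph_hom_def fibre_product_edges)
  qed
  then show ?thesis
    unfolding host_def using simple_graph_fibre_product[OF G(1) G'] c \<D>(1) d by blast
qed

end

section \<open>Arithmetic progressions\<close>

context coloured_base
begin

lemma card_F_ge_2: "2 \<le> card (verts F)"
proof -
  obtain e where "e \<in> edges F" using edges_F by auto
  then show ?thesis
    using simple_graphD[OF simple_F] card_mono[OF simple_graph_finite[OF simple_F]] by metis
qed

text \<open>Number the vertices of \<open>F\<close> by \<open>g\<close> and send \<open>a\<close> to \<open>x + g a * s\<close>. Two values of a progression at
distinct known positions determine \<open>x\<close> and \<open>s\<close>, so the \<open>M\<^sup>2\<close> copies of \<open>F\<close> obtained from all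
\<open>x, s < M\<close> are edge-disjoint. This yields arbitrarily large hosts for one fixed density.\<close>

lemma progression_host:
  "\<exists>G \<kappa>. host (1 / real (card (verts F)) ^ 4) (card (verts F) ^ 2 * M) G \<kappa>"
proof -
  define f where "f = card (verts F)"
  obtain g where g: "bij_betw g (verts F) {0..<f}"
    unfolding f_def using ex_bij_betw_finite_nat[OF simple_graph_finite[OF simple_F]] by blast
  define g' where "g' = inv_into (verts F) g"
  have gV: "g a < f" and g'g: "g' (g a) = a" if "a \<in> verts F" for a
    using that g by (auto simp: g'_def bij_betw_def)
  have g'V: "g' i \<in> verts F" if "i < f" for i
    unfolding g'_def using that g by (intro inv_into_into) (simp add: bij_betw_def)
  \<comment> \<open>The first coordinate of a vertex records its position in \<open>F\<close>, the second one its value.\<close>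
  define \<psi> where "\<psi> = (\<lambda>(x, s). \<lambda>a\<in>verts F. prod_encode (g a, x + g a * s))"
  define \<C> where "\<C> = \<psi> ` ({..<M} \<times> {..<M})"
  define G where "G = SGraph (prod_encode ` ({..<f} \<times> {..<f * M})) (\<Union>c\<in>\<C>. (\<lambda>e. c ` e) ` edges F)"
  define \<kappa> where "\<kappa> = (\<lambda>n. \<rho> (g' (pi1 n)))"
  have pV: "\<psi> (x, s) a \<in> verts G" if "a \<in> verts F" "x < M" "s < M" for x s a
  proof -
    have "x + g a * s < M + (f - 1) * M"
      using that(2,3) gV[OF that(1)] by (intro add_less_le_mono mult_le_mono) simp_all
    also have "\<dots> = f * M" using gV[OF that(1)] by (cases f) simp_all
    finally have "(g a, x + g a * s) \<in> {..<f} \<times> {..<f * M}" using gV[OF that(1)] by simp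
    then show ?thesis using that(1) by (simp add: \<psi>_def G_def)
  qed
  have inj_p: "inj_on c (verts F)" if c\<C>: "c \<in> \<C>" for c
  proof -
    obtain x s where c: "c = \<psi> (x, s)" using c\<C> by (auto simp: \<C>_def)
    have "inj_on g (verts F)" using g by (simp add: bij_betw_def)
    then show ?thesis by (simp add: c \<psi>_def inj_on_def)
  qed
  have \<kappa>p: "\<kappa> (c a) = \<rho> a" if "c \<in> \<C>" "a \<in> verts F" for c a
    using that g'g by (auto simp: \<C>_def \<psi>_def \<kappa>_def)
  have inj: "x = x' \<and> s = s'" if e: "e \<in> edges F" "e' \<in> edges F" and eq: "\<psi> (x, s) ` e = \<psi> (x', s') ` e'"
    for x s x' s' e e'
  proof -
    have sub: "e \<subseteq> verts F" "e' \<subseteq> verts F" using e simple_graphD[OF simple_F] by auto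
    have "pi1 ` \<psi> (x, s) ` e = g ` e" "pi1 ` \<psi> (x', s') ` e' = g ` e'"
      using sub by (auto simp: \<psi>_def image_iff subset_iff)
    then have "g ` e = g ` e'" using eq by simp
    moreover have "inj_on g (verts F)" using g by (simp add: bij_betw_def)
    ultimately have ee: "e = e'" using inj_on_image_eq_iff sub by blast
    obtain a b where ab: "e = {a, b}" "a \<noteq> b"
      using simple_graphD(2)[OF simple_F e(1)] by (meson card_2_iff)
    have abV: "a \<in> verts F" "b \<in> verts F" using sub ab by auto
    have gab: "g a \<noteq> g b" using ab abV g by (auto simp: bij_betw_def inj_on_def)
    have eq2: "{\<psi> (x, s) a, \<psi> (x, s) b} = {\<psi> (x', s') a, \<psi> (x', s') b}"
      using eq ab ee by simp
    moreover have "\<psi> (x, s) a \<noteq> \<psi> (x', s') b" using abV gab by (simp add: \<psi>_def)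
    ultimately have "\<psi> (x, s) a = \<psi> (x', s') a" "\<psi> (x, s) b = \<psi> (x', s') b"
      by (auto simp: doubleton_eq_iff)
    then have 1: "x + g a * s = x' + g a * s'" "x + g b * s = x' + g b * s'"
      using abV by (simp_all add: \<psi>_def)
    then have "int x + int (g a) * int s = int x' + int (g a) * int s'"
      "int x + int (g b) * int s = int x' + int (g b) * int s'"
      by (simp_all flip: of_nat_mult of_nat_add)
    then have "(int (g a) - int (g b)) * (int s - int s') = 0" by (simp add: algebra_simps)
    then have "s = s'" using gab by simp
    then show ?thesis using 1 by simp
  qed
  have G: "simple_graph G"
    unfolding simple_graph_def
  proof (intro conjI ballI)
    fix d assume "d \<in> edges G"
    then obtain c e where ce: "c \<in> \<C>" "e \<in> edges F" "d = c ` e" by (auto simp: G_def)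
    have sub: "e \<subseteq> verts F" "card e = 2" using ce(2) simple_graphD[OF simple_F] by auto
    show "d \<subseteq> verts G" using ce sub pV by (auto simp: \<C>_def)
    show "card d = 2" using ce sub inj_p by (metis card_image inj_on_subset)
  qed (simp add: G_def)
  have emb: "c \<in> embeddings F G" if "c \<in> \<C>" for c
  proof (rule embeddingsI)
    show "c \<in> extensional (verts F)" using that by (auto simp: \<C>_def \<psi>_def)
    show "c a \<in> verts G" if "a \<in> verts F" for a
      using pV that \<open>c \<in> \<C>\<close> by (auto simp: \<C>_def)
    show "c ` e \<in> edges G" if "e \<in> edges F" for e
      using that \<open>c \<in> \<C>\<close> by (auto simp: G_def)
  qed (use inj_p that in auto)
  have hom: "graph_hom G Q \<kappa>"
    unfolding graph_hom_def
  proof (intro conjI ballI Pi_I)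
    show "\<kappa> n \<in> verts Q" if "n \<in> verts G" for n
      using that g'V surj_\<rho> by (auto simp: G_def \<kappa>_def)
    fix d assume "d \<in> edges G"
    then obtain c e where ce: "c \<in> \<C>" "e \<in> edges F" "d = c ` e" by (auto simp: G_def)
    have "\<kappa> ` d = \<rho> ` e"
      unfolding ce(3) image_image
      using simple_graphD(1)[OF simple_F ce(2)] by (intro image_cong refl \<kappa>p[OF ce(1)]) auto
    then show "\<kappa> ` d \<in> edges Q" using hom_\<rho> ce(2) by (simp add: graph_hom_def)
  qed
  have pack: "packing F \<rho> G \<kappa> \<C>"
  proof (rule packingI)
    fix c c' e e' assume a: "c \<in> \<C>" "c' \<in> \<C>" "e \<in> edges F" "e' \<in> edges F" "c ` e = c' ` e'"
    then obtain x s x' s' where "c = \<psi> (x, s)" "c' = \<psi> (x', s')" by (auto simp: \<C>_def)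
    then show "c = c'" using inj[OF a(3,4)] a(5) by blast
  qed (use emb \<kappa>p in auto)
  obtain e0 where e0: "e0 \<in> edges F" using edges_F by auto
  have "inj_on \<psi> ({..<M} \<times> {..<M})"
  proof (rule inj_onI)
    fix x y assume "\<psi> x = \<psi> y"
    then show "x = y"
      using inj[OF e0 e0, of "fst x" "snd x" "fst y" "snd y"] by (simp add: prod_eq_iff)
  qed
  then have card\<C>: "card \<C> = M ^ 2"
    by (simp add: \<C>_def card_image card_cartesian_product power2_eq_square)
  have fpos: "f > 0" using card_F_ge_2 by (simp add: f_def)
  have "card {v \<in> verts G. \<kappa> v = q} \<le> f ^ 2 * M" for q
  proof -
    have "card {v \<in> verts G. \<kappa> v = q} \<le> card (verts G)"
      using G by (intro card_mono simple_graph_finite) auto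
    also have "\<dots> = f ^ 2 * M"
      by (simp add: G_def card_image inj_prod_encode card_cartesian_product power2_eq_square)
    finally show ?thesis .
  qed
  moreover have "real (f ^ 2 * M) ^ 2 = real f ^ 4 * real (card \<C>)"
    by (simp add: card\<C> power2_eq_square power4_eq_xxxx)
  then have "1 / real f ^ 4 * real (f ^ 2 * M) ^ 2 \<le> real (card \<C>)"
    using fpos by simp
  ultimately have "host (1 / real f ^ 4) (f ^ 2 * M) G \<kappa>"
    unfolding host_def using G hom pack by (intro conjI allI exI[of _ \<C>])
  then show ?thesis unfolding f_def by blast
qed

end

section \<open>Disjoint copies\<close>

definition disjoint_copies :: "nat \<Rightarrow> nat sgraph \<Rightarrow> nat sgraph" where
  "disjoint_copies m G =
     SGraph {n. pi1 n < m \<and> pi2 n \<in> verts G}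
            {e. \<exists>i<m. \<exists>d\<in>edges G. e = (\<lambda>v. prod_encode (i, v)) ` d}"

lemma disjoint_copies_verts: "n \<in> verts (disjoint_copies m G) \<longleftrightarrow> pi1 n < m \<and> pi2 n \<in> verts G"
  by (simp add: disjoint_copies_def)

lemma disjoint_copies_verts_eq: "verts (disjoint_copies m G) = prod_encode ` ({..<m} \<times> verts G)"
proof (intro set_eqI iffI)
  fix n assume "n \<in> verts (disjoint_copies m G)"
  then show "n \<in> prod_encode ` ({..<m} \<times> verts G)"
    by (intro image_eqI[of _ _ "prod_decode n"]) (auto simp: disjoint_copies_verts mem_Times_iff)
qed (auto simp: disjoint_copies_verts)

lemma card_disjoint_copies: "card (verts (disjoint_copies m G)) = m * card (verts G)"
  by (simp add: disjoint_copies_verts_eq card_image inj_prod_encode card_cartesian_product)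

lemma disjoint_copies_edge:
  assumes "e \<in> edges (disjoint_copies m G)"
  shows "\<exists>i. \<forall>n\<in>e. pi1 n = i" "pi2 ` e \<in> edges G"
proof -
  obtain i d where d: "d \<in> edges G" "e = (\<lambda>v. prod_encode (i, v)) ` d"
    using assms by (auto simp: disjoint_copies_def)
  show "\<exists>i. \<forall>n\<in>e. pi1 n = i" using d by auto
  show "pi2 ` e \<in> edges G" using d by (simp add: image_image)
qed

lemma simple_graph_disjoint_copies:
  assumes "simple_graph G"
  shows "simple_graph (disjoint_copies m G)"
  unfolding simple_graph_def
proof (intro conjI ballI)
  show "finite (verts (disjoint_copies m G))"
    using assms by (simp add: disjoint_copies_verts_eq simple_graph_finite)
  fix e assume "e \<in> edges (disjoint_copies m G)"
  then obtain i d where d: "i < m" "d \<in> edges G" "e = (\<lambda>v. prod_encode (i, v)) ` d"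
    by (auto simp: disjoint_copies_def)
  show "e \<subseteq> verts (disjoint_copies m G)"
    using d simple_graphD(1)[OF assms d(2)] by (auto simp: disjoint_copies_verts)
  have "inj_on (\<lambda>v. prod_encode (i, v)) d" by (simp add: inj_on_def)
  then show "card e = 2" using d simple_graphD(2)[OF assms d(2)] by (simp add: card_image)
qed

lemma graph_hom_disjoint_copies:
  assumes "graph_hom G Q \<kappa>"
  shows "graph_hom (disjoint_copies m G) Q (\<kappa> \<circ> pi2)"
  unfolding graph_hom_def
proof (intro conjI ballI Pi_I)
  show "(\<kappa> \<circ> pi2) n \<in> verts Q" if "n \<in> verts (disjoint_copies m G)" for n
    using assms that by (auto simp: graph_hom_def disjoint_copies_verts)
  show "(\<kappa> \<circ> pi2) ` e \<in> edges Q" if "e \<in> edges (disjoint_copies m G)" for e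
    unfolding image_comp[symmetric] using assms disjoint_copies_edge(2)[OF that] by (simp add: graph_hom_def)
qed

lemma packing_disjoint_copies:
  assumes F: "simple_graph F" "edges F \<noteq> {}" and p: "packing F \<rho> G \<kappa> \<C>" and fin: "finite \<C>"
  shows "\<exists>\<D>. packing F \<rho> (disjoint_copies m G) (\<kappa> \<circ> pi2) \<D> \<and>
    (\<forall>n\<in>verts (disjoint_copies m G).
       card {\<psi> \<in> \<C>. pi2 n \<in> \<psi> ` verts F} \<le> card {\<psi> \<in> \<D>. n \<in> \<psi> ` verts F})"
proof -
  define h where "h = (\<lambda>(i, \<psi>). \<lambda>a\<in>verts F. prod_encode (i, \<psi> a :: nat))"
  define \<D> where "\<D> = h ` ({..<m} \<times> \<C>)"
  have him: "h (i, \<psi>) ` e = (\<lambda>v. prod_encode (i, v)) ` \<psi> ` e" if "e \<in> edges F" for i \<psi> e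
    using simple_graphD(1)[OF F(1) that] by (auto simp: h_def image_iff subset_iff)
  have inj: "i = j \<and> \<psi> = \<chi>" if \<psi>: "\<psi> \<in> \<C>" "\<chi> \<in> \<C>" and e: "e \<in> edges F" "e' \<in> edges F"
    and eq: "h (i, \<psi>) ` e = h (j, \<chi>) ` e'" for i j \<psi> \<chi> e e'
  proof -
    have pis: "pi1 ` h (k, \<phi>) ` d = (\<lambda>_. k) ` d" "pi2 ` h (k, \<phi>) ` d = \<phi> ` d" if "d \<in> edges F" for k \<phi> d
      by (simp_all only: him[OF that] image_image prod_encode_inverse fst_conv snd_conv)
    have "\<psi> ` e = \<chi> ` e'" "(\<lambda>_. i) ` e = (\<lambda>_. j) ` e'"
      using arg_cong[OF eq, of "image pi2"] arg_cong[OF eq, of "image pi1"]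
      unfolding pis[OF e(1)] pis[OF e(2)] .
    moreover have "e \<noteq> {}" using simple_graphD(2)[OF F(1) e(1)] by auto
    ultimately show ?thesis using packing_edge_eq[OF p \<psi> e] by auto
  qed
  have pack: "packing F \<rho> (disjoint_copies m G) (\<kappa> \<circ> pi2) \<D>"
  proof (rule packingI)
    fix \<phi> assume "\<phi> \<in> \<D>"
    then obtain i \<psi> where i: "i < m" "\<psi> \<in> \<C>" "\<phi> = h (i, \<psi>)" by (auto simp: \<D>_def)
    note e = embeddingsD[OF packing_embedding[OF p i(2)]]
    show "\<phi> \<in> embeddings F (disjoint_copies m G)"
    proof (rule embeddingsI)
      show "\<phi> ` e \<in> edges (disjoint_copies m G)" if "e \<in> edges F" for e
        unfolding i(3) him[OF that] using i(1) e(3)[OF that] by (auto simp: disjoint_copies_def)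
    qed (use i e in \<open>auto simp: h_def disjoint_copies_verts inj_on_def\<close>)
    show "(\<kappa> \<circ> pi2) (\<phi> a) = \<rho> a" if "a \<in> verts F" for a
      using that packing_colour[OF p i(2)] by (simp add: i(3) h_def)
  next
    fix \<phi> \<phi>' e e' assume a: "\<phi> \<in> \<D>" "\<phi>' \<in> \<D>" "e \<in> edges F" "e' \<in> edges F" "\<phi> ` e = \<phi>' ` e'"
    obtain i \<psi> where i: "\<psi> \<in> \<C>" "\<phi> = h (i, \<psi>)" using a(1) by (auto simp: \<D>_def)
    obtain j \<chi> where j: "\<chi> \<in> \<C>" "\<phi>' = h (j, \<chi>)" using a(2) by (auto simp: \<D>_def)
    have "i = j \<and> \<psi> = \<chi>"
      by (rule inj[OF i(1) j(1) a(3,4)]) (use a(5) in \<open>simp only: i(2) j(2)\<close>)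
    then show "\<phi> = \<phi>'" by (simp add: i(2) j(2))
  qed
  obtain e0 where e0: "e0 \<in> edges F" using F(2) by auto
  have injh: "inj_on h (UNIV \<times> \<C>)"
  proof (rule inj_onI)
    fix x y assume xy: "x \<in> UNIV \<times> \<C>" "y \<in> UNIV \<times> \<C>" "h x = h y"
    have "fst x = fst y \<and> snd x = snd y"
    proof (rule inj[OF _ _ e0 e0])
      show "h (fst x, snd x) ` e0 = h (fst y, snd y) ` e0" using xy(3) by simp
    qed (use xy in \<open>simp_all add: mem_Times_iff\<close>)
    then show "x = y" by (simp add: prod_eq_iff)
  qed
  have "card {\<psi> \<in> \<C>. pi2 n \<in> \<psi> ` verts F} \<le> card {\<psi> \<in> \<D>. n \<in> \<psi> ` verts F}"
    if n: "n \<in> verts (disjoint_copies m G)" for n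
  proof (rule card_inj_on_le[of "\<lambda>\<psi>. h (pi1 n, \<psi>)"])
    show "inj_on (\<lambda>\<psi>. h (pi1 n, \<psi>)) {\<psi> \<in> \<C>. pi2 n \<in> \<psi> ` verts F}"
    proof (rule inj_onI)
      fix \<psi> \<chi> assume *: "\<psi> \<in> {\<psi> \<in> \<C>. pi2 n \<in> \<psi> ` verts F}" "\<chi> \<in> {\<psi> \<in> \<C>. pi2 n \<in> \<psi> ` verts F}"
        "h (pi1 n, \<psi>) = h (pi1 n, \<chi>)"
      have "(pi1 n, \<psi>) = (pi1 n, \<chi>)" by (rule inj_onD[OF injh *(3)]) (use * in auto)
      then show "\<psi> = \<chi>" by simp
    qed
    show "(\<lambda>\<psi>. h (pi1 n, \<psi>)) ` {\<psi> \<in> \<C>. pi2 n \<in> \<psi> ` verts F} \<subseteq> {\<psi> \<in> \<D>. n \<in> \<psi> ` verts F}"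
    proof (rule image_subsetI)
      fix \<psi> assume "\<psi> \<in> {\<psi> \<in> \<C>. pi2 n \<in> \<psi> ` verts F}"
      then obtain a where \<psi>: "\<psi> \<in> \<C>" "a \<in> verts F" "pi2 n = \<psi> a" by blast
      have "n = h (pi1 n, \<psi>) a" by (rule pi_eqI) (use \<psi> in \<open>simp_all add: h_def\<close>)
      then have "n \<in> h (pi1 n, \<psi>) ` verts F" using \<psi>(2) by (rule image_eqI)
      moreover have "(pi1 n, \<psi>) \<in> {..<m} \<times> \<C>"
        using \<psi>(1) n by (simp add: disjoint_copies_verts)
      then have "h (pi1 n, \<psi>) \<in> \<D>" unfolding \<D>_def by (rule imageI)
      ultimately show "h (pi1 n, \<psi>) \<in> {\<psi> \<in> \<D>. n \<in> \<psi> ` verts F}" by simp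
    qed
    show "finite {\<psi> \<in> \<D>. n \<in> \<psi> ` verts F}" using fin by (simp add: \<D>_def)
  qed
  then show ?thesis using pack by (intro exI[of _ \<D>] conjI ballI)
qed

text \<open>In a dominating set \<open>D\<close> of least size every vertex has a neighbour outside \<open>D\<close>, since otherwise it could
be removed. So the complement of \<open>D\<close> dominates as well and is at least as large as \<open>D\<close>. (The bound
is due to Ore.)\<close>

lemma small_dominating_set:
  assumes H: "simple_graph H" and cover: "\<And>v. v \<in> verts H \<Longrightarrow> \<exists>e\<in>edges H. v \<in> e"
  shows "\<exists>D\<subseteq>verts H. card D \<le> card (verts H) div 2 \<and> (\<forall>v\<in>verts H - D. \<exists>u\<in>D. {u, v} \<in> edges H)"
proof -
  define dom where "dom D \<longleftrightarrow> D \<subseteq> verts H \<and> (\<forall>v\<in>verts H - D. \<exists>u\<in>D. {u, v} \<in> edges H)" for D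
  have nbr: "\<exists>u\<in>verts H. u \<noteq> v \<and> {u, v} \<in> edges H" if v: "v \<in> verts H" for v
  proof -
    obtain e where e: "e \<in> edges H" "v \<in> e" using cover[OF v] by blast
    then obtain x y where "e = {x, y}" "x \<noteq> y" using simple_graphD(2)[OF H] by (meson card_2_iff)
    then show ?thesis using e simple_graphD(1)[OF H e(1)] by (auto simp: insert_commute)
  qed
  have "dom (verts H)" by (simp add: dom_def)
  then obtain D where D: "dom D" and least: "\<And>D'. dom D' \<Longrightarrow> card D \<le> card D'"
    using ex_has_least_nat[of dom "verts H" card] by blast
  have finH: "finite (verts H)" using H by (rule simple_graph_finite)
  have DH: "D \<subseteq> verts H" using D by (simp add: dom_def)
  have "dom (verts H - D)"
    unfolding dom_def
  proof (intro conjI ballI)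
    fix v assume "v \<in> verts H - (verts H - D)"
    then have v: "v \<in> D" "v \<in> verts H" by auto
    show "\<exists>u\<in>verts H - D. {u, v} \<in> edges H"
    proof (rule ccontr)
      assume no: "\<not> (\<exists>u\<in>verts H - D. {u, v} \<in> edges H)"
      have "dom (D - {v})"
        unfolding dom_def
      proof (intro conjI ballI)
        fix w assume w: "w \<in> verts H - (D - {v})"
        show "\<exists>u\<in>D - {v}. {u, w} \<in> edges H"
        proof (cases "w = v")
          case True
          then show ?thesis using nbr[OF v(2)] no by blast
        next
          case False
          then obtain u where u: "u \<in> D" "{u, w} \<in> edges H" using D w by (auto simp: dom_def)
          have "u \<noteq> v" using u no w False by (auto simp: insert_commute)
          then show ?thesis using u by blast
        qed
      qed (use DH in auto)
      then have "card D \<le> card (D - {v})" by (rule least)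
      moreover have "card (D - {v}) < card D"
        using v finH DH by (intro card_Diff1_less) (auto intro: finite_subset)
      ultimately show False by simp
    qed
  qed auto
  then have "card D \<le> card (verts H - D)" by (rule least)
  then have "card D \<le> card (verts H) div 2"
    using card_Diff_subset[OF finite_subset[OF DH finH] DH] by linarith
  then show ?thesis using D by (auto simp: dom_def)
qed

text \<open>A homomorphism to disjoint copies of \<open>G\<close> consists of a homomorphism to \<open>G\<close> and the choice of a copy for
each vertex. Adjacent vertices lie in the same copy, so the choices on a dominating set determine the
others. This replaces counting the components of \<open>H\<close>.\<close>

lemma hom_count_disjoint_copies:
  assumes H: "simple_graph H" and cover: "\<And>v. v \<in> verts H \<Longrightarrow> \<exists>e\<in>edges H. v \<in> e"
    and G: "simple_graph G" and m: "m > 0"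
  shows "hom_count H \<sigma> (disjoint_copies m G) (\<kappa> \<circ> pi2) \<le> m ^ (card (verts H) div 2) * hom_count H \<sigma> G \<kappa>"
proof -
  let ?P = "disjoint_copies m G"
  obtain D where D: "D \<subseteq> verts H" "card D \<le> card (verts H) div 2"
    and dom: "\<And>v. v \<in> verts H - D \<Longrightarrow> \<exists>u\<in>D. {u, v} \<in> edges H"
    using small_dominating_set[OF H cover] by blast
  have finH: "finite (verts H)" using H by (rule simple_graph_finite)
  have finD: "finite D" using D finH by (blast intro: finite_subset)
  let ?r = "\<lambda>\<phi>. (restrict (pi1 \<circ> \<phi>) D, restrict (pi2 \<circ> \<phi>) (verts H))"
  have same: "pi1 (\<phi> u) = pi1 (\<phi> v)" if "\<phi> \<in> colour_homs H \<sigma> ?P (\<kappa> \<circ> pi2)" "{u, v} \<in> edges H" for \<phi> u v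
  proof -
    have "\<phi> ` {u, v} \<in> edges ?P" using that unfolding colour_homs_def by blast
    then show ?thesis using disjoint_copies_edge(1) by fastforce
  qed
  have "inj_on ?r (colour_homs H \<sigma> ?P (\<kappa> \<circ> pi2))"
  proof (rule inj_onI)
    fix \<phi> \<phi>' assume a: "\<phi> \<in> colour_homs H \<sigma> ?P (\<kappa> \<circ> pi2)" "\<phi>' \<in> colour_homs H \<sigma> ?P (\<kappa> \<circ> pi2)"
      and eq: "?r \<phi> = ?r \<phi>'"
    have eD: "pi1 (\<phi> u) = pi1 (\<phi>' u)" if "u \<in> D" for u
    proof -
      have "restrict (pi1 \<circ> \<phi>) D u = restrict (pi1 \<circ> \<phi>') D u" using eq by simp
      then show ?thesis using that by simp
    qed
    have e2: "pi2 (\<phi> v) = pi2 (\<phi>' v)" if "v \<in> verts H" for v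
    proof -
      have "restrict (pi2 \<circ> \<phi>) (verts H) v = restrict (pi2 \<circ> \<phi>') (verts H) v" using eq by simp
      then show ?thesis using that by simp
    qed
    have e1: "pi1 (\<phi> v) = pi1 (\<phi>' v)" if v: "v \<in> verts H" for v
    proof (cases "v \<in> D")
      case False
      then obtain u where "u \<in> D" "{u, v} \<in> edges H" using dom v by blast
      then show ?thesis using same[OF a(1)] same[OF a(2)] eD by metis
    qed (rule eD)
    show "\<phi> = \<phi>'"
    proof (rule extensionalityI[of _ "verts H"])
      show "\<phi> v = \<phi>' v" if "v \<in> verts H" for v
        using e1[OF that] e2[OF that] by (rule pi_eqI)
    qed (use a in \<open>auto simp: colour_homs_def PiE_def\<close>)
  qed
  moreover have "?r ` colour_homs H \<sigma> ?P (\<kappa> \<circ> pi2) \<subseteq> (D \<rightarrow>\<^sub>E {..<m}) \<times> colour_homs H \<sigma> G \<kappa>"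
  proof (rule image_subsetI)
    fix \<phi> assume a: "\<phi> \<in> colour_homs H \<sigma> ?P (\<kappa> \<circ> pi2)"
    have v: "\<phi> v \<in> verts ?P" "\<kappa> (pi2 (\<phi> v)) = \<sigma> v" if "v \<in> verts H" for v
      using a that by (auto simp: colour_homs_def)
    have "restrict (pi1 \<circ> \<phi>) D \<in> D \<rightarrow>\<^sub>E {..<m}"
      using v D(1) by (auto simp: disjoint_copies_verts)
    moreover have "restrict (pi2 \<circ> \<phi>) (verts H) \<in> colour_homs H \<sigma> G \<kappa>"
      unfolding colour_homs_def mem_Collect_eq
    proof (intro conjI ballI)
      fix e assume e: "e \<in> edges H"
      have "restrict (pi2 \<circ> \<phi>) (verts H) ` e = pi2 ` \<phi> ` e"
        using simple_graphD(1)[OF H e] by (auto simp: image_iff subset_iff)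
      moreover have "pi2 ` \<phi> ` e \<in> edges G"
        using a e by (intro disjoint_copies_edge(2)) (auto simp: colour_homs_def)
      ultimately show "restrict (pi2 \<circ> \<phi>) (verts H) ` e \<in> edges G" by (simp only:)
    qed (use v in \<open>auto simp: disjoint_copies_verts\<close>)
    ultimately show "?r \<phi> \<in> (D \<rightarrow>\<^sub>E {..<m}) \<times> colour_homs H \<sigma> G \<kappa>" by simp
  qed
  ultimately have "hom_count H \<sigma> ?P (\<kappa> \<circ> pi2) \<le> card ((D \<rightarrow>\<^sub>E {..<m}) \<times> colour_homs H \<sigma> G \<kappa>)"
    unfolding hom_count_def using finH finD simple_graph_finite[OF G]
    by (intro card_inj_on_le[of ?r]) (auto intro!: finite_PiE colour_homs_finite finite_cartesian_product)
  also have "\<dots> = m ^ card D * hom_count H \<sigma> G \<kappa>"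
    using finD by (simp add: card_cartesian_product card_PiE hom_count_def)
  also have "\<dots> \<le> m ^ (card (verts H) div 2) * hom_count H \<sigma> G \<kappa>"
    using D(2) m by (intro mult_right_mono power_increasing) auto
  finally show ?thesis .
qed

section \<open>Representatives of isomorphism classes\<close>

lemma nat_representative:
  fixes H :: "'a sgraph" and \<sigma> :: "'a \<Rightarrow> 'c"
  assumes H: "simple_graph H"
  obtains H' :: "nat sgraph" and \<sigma>' :: "nat \<Rightarrow> 'c"
  where "simple_graph H'" "verts H' = {..<card (verts H)}"
    "\<sigma>' \<in> {..<card (verts H)} \<rightarrow>\<^sub>E \<sigma> ` verts H"
    "\<And>(G :: nat sgraph) \<kappa>. hom_count H' \<sigma>' G \<kappa> = hom_count H \<sigma> G \<kappa>"
proof -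
  define n where "n = card (verts H)"
  obtain h where h: "bij_betw h {..<n} (verts H)"
    using ex_bij_betw_nat_finite[OF simple_graph_finite[OF H]] by (auto simp: n_def atLeast0LessThan)
  define k where "k = inv_into {..<n} h"
  have hV: "h i \<in> verts H" "k (h i) = i" if "i < n" for i
    using that h by (auto simp: k_def bij_betw_def)
  have kV: "k v < n" "h (k v) = v" if "v \<in> verts H" for v
  proof -
    have "v \<in> h ` {..<n}" using h that by (simp add: bij_betw_def)
    then show "k v < n" "h (k v) = v"
      using inv_into_into[of v h "{..<n}"] f_inv_into_f[of v h "{..<n}"] by (simp_all add: k_def)
  qed
  define H' where "H' = SGraph {..<n} {d. d \<subseteq> {..<n} \<and> h ` d \<in> edges H}"
  define \<sigma>' where "\<sigma>' = restrict (\<sigma> \<circ> h) {..<n}"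
  have "hom_count H' \<sigma>' G \<kappa> = hom_count H \<sigma> G \<kappa>" for G :: "nat sgraph" and \<kappa>
    unfolding hom_count_def
  proof (rule bij_betw_same_card[of "\<lambda>\<phi>. restrict (\<phi> \<circ> k) (verts H)"],
      rule bij_betw_byWitness[where f' = "\<lambda>\<phi>. restrict (\<phi> \<circ> h) {..<n}"])
    show "\<forall>\<phi>\<in>colour_homs H' \<sigma>' G \<kappa>. restrict (restrict (\<phi> \<circ> k) (verts H) \<circ> h) {..<n} = \<phi>"
    proof
      fix \<phi> assume "\<phi> \<in> colour_homs H' \<sigma>' G \<kappa>"
      then have "\<phi> \<in> extensional {..<n}" by (simp add: colour_homs_def H'_def PiE_def)
      then show "restrict (restrict (\<phi> \<circ> k) (verts H) \<circ> h) {..<n} = \<phi>"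
        by (intro extensionalityI[of _ "{..<n}"]) (simp_all add: hV)
    qed
    show "\<forall>\<phi>\<in>colour_homs H \<sigma> G \<kappa>. restrict (restrict (\<phi> \<circ> h) {..<n} \<circ> k) (verts H) = \<phi>"
    proof
      fix \<phi> assume "\<phi> \<in> colour_homs H \<sigma> G \<kappa>"
      then have "\<phi> \<in> extensional (verts H)" by (simp add: colour_homs_def PiE_def)
      then show "restrict (restrict (\<phi> \<circ> h) {..<n} \<circ> k) (verts H) = \<phi>"
        by (intro extensionalityI[of _ "verts H"]) (simp_all add: kV)
    qed
    show "(\<lambda>\<phi>. restrict (\<phi> \<circ> k) (verts H)) ` colour_homs H' \<sigma>' G \<kappa> \<subseteq> colour_homs H \<sigma> G \<kappa>"
    proof (rule image_subsetI)
      fix \<phi> assume a: "\<phi> \<in> colour_homs H' \<sigma>' G \<kappa>"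
      have v: "\<phi> i \<in> verts G" "\<kappa> (\<phi> i) = \<sigma> (h i)" if "i < n" for i
        using a that by (auto simp: colour_homs_def H'_def \<sigma>'_def)
      show "restrict (\<phi> \<circ> k) (verts H) \<in> colour_homs H \<sigma> G \<kappa>"
        unfolding colour_homs_def mem_Collect_eq
      proof (intro conjI ballI)
        fix e assume e: "e \<in> edges H"
        have im: "restrict (\<phi> \<circ> k) (verts H) ` e = \<phi> ` k ` e"
          unfolding image_image using simple_graphD(1)[OF H e] by (intro image_cong) auto
        have "h ` k ` e = e"
          unfolding image_image using simple_graphD(1)[OF H e] kV(2) by (auto simp: subset_iff image_iff)
        moreover have "k ` e \<subseteq> {..<n}" using simple_graphD(1)[OF H e] kV(1) by auto
        ultimately have "k ` e \<in> edges H'" using e by (simp add: H'_def)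
        then show "restrict (\<phi> \<circ> k) (verts H) ` e \<in> edges G"
          unfolding im using a by (simp add: colour_homs_def)
      qed (use v kV in auto)
    qed
    show "(\<lambda>\<phi>. restrict (\<phi> \<circ> h) {..<n}) ` colour_homs H \<sigma> G \<kappa> \<subseteq> colour_homs H' \<sigma>' G \<kappa>"
    proof (rule image_subsetI)
      fix \<phi> assume a: "\<phi> \<in> colour_homs H \<sigma> G \<kappa>"
      have v: "\<phi> v \<in> verts G" "\<kappa> (\<phi> v) = \<sigma> v" if "v \<in> verts H" for v
        using a that by (auto simp: colour_homs_def)
      show "restrict (\<phi> \<circ> h) {..<n} \<in> colour_homs H' \<sigma>' G \<kappa>"
        unfolding colour_homs_def mem_Collect_eq
      proof (intro conjI ballI)
        fix d assume d: "d \<in> edges H'"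
        have im: "restrict (\<phi> \<circ> h) {..<n} ` d = \<phi> ` h ` d"
          unfolding image_image using d by (intro image_cong) (auto simp: H'_def)
        show "restrict (\<phi> \<circ> h) {..<n} ` d \<in> edges G"
          unfolding im using a d by (simp add: colour_homs_def H'_def)
      qed (use v hV in \<open>auto simp: H'_def \<sigma>'_def\<close>)
    qed
  qed
  moreover have "simple_graph H'"
    unfolding simple_graph_def
  proof (intro conjI ballI)
    fix d assume d: "d \<in> edges H'"
    then show "d \<subseteq> verts H'" by (simp add: H'_def)
    have "inj_on h d" using d h by (auto simp: H'_def bij_betw_def intro: inj_on_subset)
    moreover have "card (h ` d) = 2" using d by (auto simp: H'_def intro: simple_graphD(2)[OF H])
    ultimately show "card d = 2" by (simp add: card_image)
  qed (simp add: H'_def)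
  moreover have "\<sigma>' \<in> {..<n} \<rightarrow>\<^sub>E \<sigma> ` verts H" using hV by (auto simp: \<sigma>'_def)
  ultimately show ?thesis
    by (intro that[of H' \<sigma>']) (auto simp: H'_def n_def)
qed

section \<open>Two estimates on powers\<close>

text \<open>On a logarithmic scale, suitable multiples of any two positive numbers differ by at most a factor of two.\<close>

lemma balanced_powers:
  fixes a b :: real
  assumes "0 < a" "a < 1" "0 < b" "b < 1"
  shows "\<exists>k l. a ^ (2 * Suc k) \<le> b ^ Suc l \<and> b ^ (2 * Suc l) \<le> a ^ Suc k"
proof -
  have *: "\<exists>l. a ^ 2 \<le> b ^ Suc l \<and> b ^ (2 * Suc l) \<le> a"
    if "0 < a" "a < 1" "0 < b" "b < 1" "a \<le> b" for a b :: real
  proof -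
    have "\<exists>m. b ^ m < a" using real_arch_pow_inv[of a b] that by blast
    \<comment> \<open>The first power of \<open>b\<close> below \<open>a\<close>; the one before it is the required power.\<close>
    then obtain m where m: "b ^ m < a" "\<And>k. k < m \<Longrightarrow> \<not> b ^ k < a"
      using exists_least_iff[of "\<lambda>m. b ^ m < a"] by blast
    have "m \<noteq> 0" using m(1) that by (intro notI) simp
    moreover have "m \<noteq> 1" using m(1) that by (intro notI) simp
    ultimately obtain l where l: "m = Suc (Suc l)" by (metis One_nat_def not0_implies_Suc)
    have "a \<le> b ^ Suc l" using m(2)[of "Suc l"] l by simp
    moreover have "a ^ 2 \<le> a" using that power_decreasing[of 1 2 a] by simp
    moreover have "b ^ (2 * Suc l) \<le> b ^ m" using that l by (intro power_decreasing) auto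
    ultimately show ?thesis using m(1) by (intro exI[of _ l]) linarith
  qed
  show ?thesis
  proof (cases "a \<le> b")
    case True
    then obtain l where "a ^ 2 \<le> b ^ Suc l" "b ^ (2 * Suc l) \<le> a" using * assms by blast
    then show ?thesis by (intro exI[of _ 0] exI[of _ l]) simp
  next
    case False
    then obtain k where "b ^ 2 \<le> a ^ Suc k" "a ^ (2 * Suc k) \<le> b" using *[of b a] assms by auto
    then show ?thesis by (intro exI[of _ k] exI[of _ 0]) simp
  qed
qed

text \<open>Here \<open>x\<close> is the packing density before, and \<open>x / m\<close> the one after, passing to about \<open>1/x\<close> disjoint
copies. As \<open>x / m\<close> is at least \<open>x\<^sup>3\<close>, a large power of \<open>x\<close> beats \<open>c (x / m)\<^sup>C\<close>. Since \<open>x\<close> stays below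
\<open>1/2\<close>, the constant \<open>c\<close> can be absorbed into the exponent.\<close>

lemma dominating_exponent:
  fixes c C :: real
  assumes "0 < c" "0 < C"
  shows "\<exists>d::nat. \<forall>x m. 0 < x \<and> x \<le> 1 / 2 \<and> 0 < m \<and> m \<le> 2 / x \<longrightarrow> x ^ d < c * (x / m) powr C"
proof -
  define k where "k = nat \<lceil>C\<rceil>"
  have k: "C \<le> real k" using assms by (simp add: k_def)
  obtain j where j: "(1 / 2 :: real) ^ j < c" using real_arch_pow_inv[of c "1/2"] assms by auto
  show ?thesis
  proof (intro exI[of _ "j + 3 * k"] allI impI)
    fix x m :: real assume "0 < x \<and> x \<le> 1 / 2 \<and> 0 < m \<and> m \<le> 2 / x"
    then have x: "0 < x" "x \<le> 1 / 2" and m: "0 < m" "m \<le> 2 / x" by auto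
    have "x ^ 3 * m \<le> x ^ 3 * (2 / x)" using x m by (intro mult_left_mono) auto
    also have "\<dots> = x * (2 * x)" using x by (simp add: power3_eq_cube)
    also have "\<dots> \<le> x * 1" using x by (intro mult_left_mono) auto
    finally have 1: "x ^ 3 \<le> x / m" using m by (simp add: pos_le_divide_eq)
    have "x ^ (3 * k) = (x ^ 3) powr real k" using x by (simp add: powr_realpow power_mult)
    also have "\<dots> \<le> (x ^ 3) powr C"
      using x k by (intro powr_mono') (auto simp: power_le_one)
    also have "\<dots> \<le> (x / m) powr C" using 1 x assms by (intro powr_mono2) auto
    finally have 2: "x ^ (3 * k) \<le> (x / m) powr C" .
    have "x ^ (j + 3 * k) = x ^ j * x ^ (3 * k)" by (simp add: power_add)
    also have "\<dots> \<le> (1 / 2) ^ j * x ^ (3 * k)"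
      using x by (intro mult_right_mono power_mono) auto
    also have "\<dots> < c * x ^ (3 * k)" using j x by (intro mult_strict_right_mono) auto
    also have "\<dots> \<le> c * (x / m) powr C" using 2 assms by (intro mult_left_mono) auto
    finally show "x ^ (j + 3 * k) < c * (x / m) powr C" .
  qed
qed

section \<open>Suppressing finitely many patterns at once\<close>

context coloured_base
begin

lemma hostD:
  assumes "host \<epsilon> N G \<kappa>"
  shows "simple_graph G" "graph_hom G Q \<kappa>" "\<And>q. card {v \<in> verts G. \<kappa> v = q} \<le> N"
  using assms by (auto simp: host_def)

text \<open>The function \<open>\<eta>\<close> records upper bounds on the homomorphism densities of all patterns simultaneously, most
of them trivial. Then a single product lemma serves both for powers of a host and for combining hosts
for different patterns.\<close>

definition attains :: "real \<Rightarrow> (nat sgraph \<times> (nat \<Rightarrow> 'c) \<Rightarrow> real) \<Rightarrow> bool" where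
  "attains \<epsilon> \<eta> \<longleftrightarrow>
     (\<forall>n\<^sub>0. \<exists>N\<ge>n\<^sub>0. \<exists>G \<kappa>. host \<epsilon> N G \<kappa> \<and>
        (\<forall>H \<sigma>. simple_graph H \<longrightarrow> real (hom_count H \<sigma> G \<kappa>) \<le> \<eta> (H, \<sigma>) * real N ^ card (verts H)))"

text \<open>The analogue of non-abundance in terms of hosts and homomorphisms.\<close>

definition suppressible :: "nat sgraph \<times> (nat \<Rightarrow> 'c) \<Rightarrow> bool" where
  "suppressible K \<longleftrightarrow>
     (\<forall>C::nat. \<exists>\<epsilon>. 0 < \<epsilon> \<and> \<epsilon> < 1 \<and> attains \<epsilon> (\<lambda>K'. if K' = K then \<epsilon> ^ C else 1))"

lemma attains_mono:
  assumes "attains \<epsilon> \<eta>" "\<And>K. \<eta> K \<le> \<eta>' K"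
  shows "attains \<epsilon> \<eta>'"
  unfolding attains_def
proof
  fix n\<^sub>0
  obtain N G \<kappa> where N: "N \<ge> n\<^sub>0" "host \<epsilon> N G \<kappa>"
    and le: "\<And>H \<sigma>. simple_graph H \<Longrightarrow> real (hom_count H \<sigma> G \<kappa>) \<le> \<eta> (H, \<sigma>) * real N ^ card (verts H)"
    using assms(1) unfolding attains_def by blast
  have "real (hom_count H \<sigma> G \<kappa>) \<le> \<eta>' (H, \<sigma>) * real N ^ card (verts H)" if "simple_graph H" for H \<sigma>
    using le[OF that, of \<sigma>] assms(2)[of "(H, \<sigma>)"] by (meson dual_order.trans mult_right_mono zero_le_power of_nat_0_le_iff)
  then show "\<exists>N\<ge>n\<^sub>0. \<exists>G \<kappa>. host \<epsilon> N G \<kappa> \<and>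
      (\<forall>H \<sigma>. simple_graph H \<longrightarrow> real (hom_count H \<sigma> G \<kappa>) \<le> \<eta>' (H, \<sigma>) * real N ^ card (verts H))"
    using N by blast
qed

lemma attains_product:
  assumes a: "attains \<epsilon> \<eta>" and a': "attains \<epsilon>' \<eta>'" and pos: "0 \<le> \<epsilon>" "0 \<le> \<epsilon>'" "\<And>K. 0 \<le> \<eta> K" "\<And>K. 0 \<le> \<eta>' K"
  shows "attains (\<epsilon> * \<epsilon>') (\<lambda>K. \<eta> K * \<eta>' K)"
  unfolding attains_def
proof
  fix n\<^sub>0
  obtain N G \<kappa> where N: "N \<ge> n\<^sub>0" "host \<epsilon> N G \<kappa>"
    and le: "\<And>H \<sigma>. simple_graph H \<Longrightarrow> real (hom_count H \<sigma> G \<kappa>) \<le> \<eta> (H, \<sigma>) * real N ^ card (verts H)"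
    using a unfolding attains_def by blast
  obtain N' G' \<kappa>' where N': "N' \<ge> 1" "host \<epsilon>' N' G' \<kappa>'"
    and le': "\<And>H \<sigma>. simple_graph H \<Longrightarrow> real (hom_count H \<sigma> G' \<kappa>') \<le> \<eta>' (H, \<sigma>) * real N' ^ card (verts H)"
    using a' unfolding attains_def by blast
  let ?P = "fibre_product G \<kappa> G' \<kappa>'"
  have "real (hom_count H \<sigma> ?P (\<kappa> \<circ> pi1)) \<le> \<eta> (H, \<sigma>) * \<eta>' (H, \<sigma>) * real (N * N') ^ card (verts H)"
    if H: "simple_graph H" for H \<sigma>
  proof -
    have "hom_count H \<sigma> ?P (\<kappa> \<circ> pi1) \<le> hom_count H \<sigma> G \<kappa> * hom_count H \<sigma> G' \<kappa>'"
      using simple_graph_finite[OF H] simple_graph_finite[OF hostD(1)[OF N(2)]]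
        simple_graph_finite[OF hostD(1)[OF N'(2)]] simple_graphD(1)[OF H]
      by (rule hom_count_fibre_product)
    then have "real (hom_count H \<sigma> ?P (\<kappa> \<circ> pi1)) \<le> real (hom_count H \<sigma> G \<kappa>) * real (hom_count H \<sigma> G' \<kappa>')"
      by (metis of_nat_le_iff of_nat_mult)
    also have "\<dots> \<le> (\<eta> (H, \<sigma>) * real N ^ card (verts H)) * (\<eta>' (H, \<sigma>) * real N' ^ card (verts H))"
      using le[OF H] le'[OF H] pos by (intro mult_mono) auto
    also have "\<dots> = \<eta> (H, \<sigma>) * \<eta>' (H, \<sigma>) * real (N * N') ^ card (verts H)"
      by (simp add: power_mult_distrib)
    finally show ?thesis .
  qed
  moreover have "host (\<epsilon> * \<epsilon>') (N * N') ?P (\<kappa> \<circ> pi1)"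
    using N(2) N'(2) pos by (intro host_product)
  moreover have "n\<^sub>0 \<le> N * N'"
  proof -
    have "n\<^sub>0 * 1 \<le> N * N'" using N(1) N'(1) by (rule mult_le_mono)
    then show ?thesis by simp
  qed
  ultimately show "\<exists>N\<ge>n\<^sub>0. \<exists>G \<kappa>. host (\<epsilon> * \<epsilon>') N G \<kappa> \<and>
      (\<forall>H \<sigma>. simple_graph H \<longrightarrow>
        real (hom_count H \<sigma> G \<kappa>) \<le> \<eta> (H, \<sigma>) * \<eta>' (H, \<sigma>) * real N ^ card (verts H))"
    by blast
qed

lemma attains_power:
  assumes "attains \<epsilon> \<eta>" "0 \<le> \<epsilon>" "\<And>K. 0 \<le> \<eta> K"
  shows "attains (\<epsilon> ^ Suc k) (\<lambda>K. \<eta> K ^ Suc k)"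
proof (induction k)
  case (Suc k)
  have "attains (\<epsilon> * \<epsilon> ^ Suc k) (\<lambda>K. \<eta> K * \<eta> K ^ Suc k)"
    using assms Suc.IH by (intro attains_product) auto
  then show ?case by simp
qed (use assms in simp)

lemma attains_progression: "attains (1 / real (card (verts F)) ^ 4) (\<lambda>_. 1)"
  unfolding attains_def
proof
  fix n\<^sub>0
  let ?N = "card (verts F) ^ 2 * n\<^sub>0"
  obtain G \<kappa> where G: "host (1 / real (card (verts F)) ^ 4) ?N G \<kappa>"
    using progression_host by blast
  have "1 * n\<^sub>0 \<le> ?N"
    using card_F_ge_2 by (intro mult_le_mono1) simp
  moreover have "real (hom_count H \<sigma> G \<kappa>) \<le> 1 * real ?N ^ card (verts H)" if "simple_graph H" for H \<sigma>
    using hom_count_le_power[OF simple_graph_finite[OF that] simple_graph_finite[OF hostD(1)[OF G]] hostD(3)[OF G], of \<sigma>]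
    by (metis mult_1 of_nat_le_iff of_nat_power)
  ultimately show "\<exists>N\<ge>n\<^sub>0. \<exists>G \<kappa>. host (1 / real (card (verts F)) ^ 4) N G \<kappa> \<and>
      (\<forall>H \<sigma>. simple_graph H \<longrightarrow> real (hom_count H \<sigma> G \<kappa>) \<le> 1 * real N ^ card (verts H))"
    using G by (intro exI[of _ ?N] conjI exI[of _ G] exI[of _ \<kappa>]) auto
qed

text \<open>Induction on \<open>S\<close>. Let \<open>x\<close> and \<open>y\<close> be the balanced powers of the densities for \<open>S\<close> and for a new pattern
\<open>K\<close>. Each of them is at least the square of the other, so a bound with exponent \<open>3 C\<close> in terms of \<open>x\<close> or
of \<open>y\<close> alone is a bound with exponent \<open>C\<close> in terms of \<open>x y\<close>, the density of the product. The base case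
supplies a host with a sufficiently small density, and densities only decrease afterwards.\<close>

lemma jointly_suppressible:
  assumes "finite S" "\<And>K. K \<in> S \<Longrightarrow> suppressible K"
  shows "\<exists>\<epsilon>. 0 < \<epsilon> \<and> \<epsilon> \<le> 1 / (2 * real (card (verts F)) ^ 2) \<and>
           attains \<epsilon> (\<lambda>K. if K \<in> S then \<epsilon> ^ C else 1)"
  using assms
proof (induction S arbitrary: C rule: finite_induct)
  case empty
  have f: "2 \<le> real (card (verts F))" using card_F_ge_2 by simp
  have "2 * real (card (verts F)) ^ 2 \<le> real (card (verts F)) ^ 2 * real (card (verts F)) ^ 2"
    using power_mono[OF f, of 2] by (intro mult_right_mono) auto
  also have "\<dots> = real (card (verts F)) ^ 4" by (simp flip: power_add)
  finally have "1 / real (card (verts F)) ^ 4 \<le> 1 / (2 * real (card (verts F)) ^ 2)"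
    using f by (intro divide_left_mono) (auto intro!: mult_pos_pos)
  then show ?case
    using attains_progression f by (intro exI[of _ "1 / real (card (verts F)) ^ 4"]) auto
next
  case (insert K S)
  obtain a where a: "0 < a" "a \<le> 1 / (2 * real (card (verts F)) ^ 2)"
    and atta: "attains a (\<lambda>K. if K \<in> S then a ^ (3 * C) else 1)"
    using insert.IH[of "3 * C"] insert.prems by auto
  obtain b where b: "0 < b" "b < 1" and attb: "attains b (\<lambda>K'. if K' = K then b ^ (3 * C) else 1)"
    using insert.prems[of K] unfolding suppressible_def by blast
  have "1 \<le> real (card (verts F)) ^ 2"
    using card_F_ge_2 by (intro one_le_power) simp
  then have "1 / (2 * real (card (verts F)) ^ 2) \<le> 1 / (2 * 1)"
    using card_F_ge_2 by (intro divide_left_mono mult_left_mono) auto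
  then have a1: "a < 1" using a by linarith
  obtain k l where kl: "a ^ (2 * Suc k) \<le> b ^ Suc l" "b ^ (2 * Suc l) \<le> a ^ Suc k"
    using balanced_powers[OF a(1) a1 b] by blast
  define x y where "x = a ^ Suc k" and "y = b ^ Suc l"
  have x: "0 < x" "x \<le> a" "x \<le> 1" and y: "0 < y" "y \<le> 1"
    using a a1 b power_le_one[of b "Suc l"] power_le_one[of a k] mult_left_le[of "a ^ k" a]
    by (auto simp: x_def y_def mult_le_one)
  have xy: "x ^ 2 \<le> y" "y ^ 2 \<le> x"
    using kl by (simp_all only: x_def y_def power_mult[symmetric] mult.commute)
  have "attains (x * y) (\<lambda>K'. (if K' \<in> S then a ^ (3 * C) else 1) ^ Suc k * (if K' = K then b ^ (3 * C) else 1) ^ Suc l)"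
    unfolding x_def y_def using atta attb a b by (intro attains_product attains_power) auto
  then have "attains (x * y) (\<lambda>K'. if K' \<in> insert K S then (x * y) ^ C else 1)"
  proof (rule attains_mono)
    fix K'
    have xC: "(a ^ (3 * C)) ^ Suc k = x ^ (3 * C)" and yC: "(b ^ (3 * C)) ^ Suc l = y ^ (3 * C)"
      by (simp_all only: x_def y_def power_mult[symmetric] mult.commute)
    have "x ^ 3 \<le> x * y"
      using xy(1) x by (simp add: power3_eq_cube power2_eq_square)
    then have xle: "x ^ (3 * C) \<le> (x * y) ^ C"
      unfolding power_mult using x by (intro power_mono) auto
    have "y ^ 3 \<le> x * y"
      using xy(2) y by (simp add: power3_eq_cube power2_eq_square)
    then have yle: "y ^ (3 * C) \<le> (x * y) ^ C"
      unfolding power_mult using y by (intro power_mono) auto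
    have x1: "0 \<le> x ^ (3 * C)" "x ^ (3 * C) \<le> 1" and y1: "0 \<le> y ^ (3 * C)" "y ^ (3 * C) \<le> 1"
      using x y by (auto simp: power_le_one)
    have "x ^ (3 * C) * y ^ (3 * C) \<le> x ^ (3 * C)"
      using x1 y1 by (intro mult_left_le) auto
    then show "(if K' \<in> S then a ^ (3 * C) else 1) ^ Suc k * (if K' = K then b ^ (3 * C) else 1) ^ Suc l
        \<le> (if K' \<in> insert K S then (x * y) ^ C else 1)"
      using xle yle insert.hyps(2) unfolding if_distrib[of "\<lambda>z. z ^ Suc k"] if_distrib[of "\<lambda>z. z ^ Suc l"] xC yC
      by auto
  qed
  moreover have "x * y \<le> a" using x y mult_left_le[of y x] by linarith
  ultimately show ?case using x y a by (intro exI[of _ "x * y"]) auto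
qed

text \<open>Each isolated vertex costs at most a factor \<open>\<epsilon> / b\<close>, by the lower bound on colour classes in a host, and
non-injective maps are negligible for large \<open>n\<close>. Both are paid for by a larger exponent \<open>D\<close> in the
hypothesis.\<close>

lemma suppressible_trim:
  fixes H :: "'k sgraph" and b :: real
  assumes H: "simple_graph H" "\<sigma> ` verts H \<subseteq> verts Q" and b: "1 < b"
    and sparse: "\<And>c C :: real. 0 < c \<Longrightarrow> 0 < C \<Longrightarrow> \<exists>\<epsilon>. 0 < \<epsilon> \<and> \<epsilon> \<le> 1 \<and>
      (\<forall>n\<^sub>0. \<exists>n\<ge>n\<^sub>0. \<exists>G \<kappa>. host (\<epsilon> / b) n G \<kappa> \<and> card (verts G) \<le> n \<and>
         real (emb_count H \<sigma> G \<kappa>) < c * \<epsilon> powr C * real n ^ card (verts H))"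
    and rep: "card (verts H') = card (verts (trim H))"
      "\<And>(G :: nat sgraph) \<kappa>. hom_count H' \<sigma>' G \<kappa> = hom_count (trim H) \<sigma> G \<kappa>"
  shows "suppressible (H', \<sigma>')"
  unfolding suppressible_def
proof
  fix C :: nat
  define v i D where "v = card (verts (trim H))" and "i = card (isolated_verts H)" and "D = C + i + 1"
  have fin: "finite (verts H)" using H(1) by (rule simple_graph_finite)
  have vi: "card (verts H) = v + i" using card_trim_isolated[OF fin] by (simp add: v_def i_def)
  have "0 < 1 / (2 * b ^ D)" "0 < real D" using b by (simp_all add: D_def)
  from sparse[OF this] obtain \<epsilon> where \<epsilon>: "0 < \<epsilon>" "\<epsilon> \<le> 1"
    and G: "\<forall>n\<^sub>0. \<exists>n\<ge>n\<^sub>0. \<exists>G \<kappa>. host (\<epsilon> / b) n G \<kappa> \<and> card (verts G) \<le> n \<and>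
         real (emb_count H \<sigma> G \<kappa>) < 1 / (2 * b ^ D) * \<epsilon> powr real D * real n ^ card (verts H)"
    by (elim exE conjE)
  define x where "x = \<epsilon> / b"
  have x: "0 < x" "x < 1" using \<epsilon> b by (auto simp: x_def)
  \<comment> \<open>The constant is chosen so that the bound on embeddings is half of the bound in terms of \<open>x\<close>. The other half covers the non-injective maps.\<close>
  have half: "1 / (2 * b ^ D) * \<epsilon> powr real D = x ^ D / 2"
    using \<epsilon> by (simp add: x_def powr_realpow power_divide)
  have "attains x (\<lambda>K'. if K' = (H', \<sigma>') then x ^ C else 1)"
    unfolding attains_def
  proof
    fix n\<^sub>0
    obtain n1 where n1: "real (card (verts H) ^ 2) \<le> x ^ D / 2 * real n1"
      using real_arch_simple[of "real (card (verts H) ^ 2) / (x ^ D / 2)"] x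
      by (auto simp: divide_le_eq mult.commute)
    obtain n G \<kappa> where n: "n \<ge> n\<^sub>0 + n1 + 1" "host x n G \<kappa>" "card (verts G) \<le> n"
      and small: "real (emb_count H \<sigma> G \<kappa>) < x ^ D / 2 * real n ^ card (verts H)"
      using G[rule_format, of "n\<^sub>0 + n1 + 1"] unfolding half x_def[symmetric] by (elim exE conjE)
    note hG = hostD[OF n(2)]
    have finG: "finite (verts G)" using hG(1) by (rule simple_graph_finite)
    have npos: "0 < real n" using n(1) by simp
    have "card (verts H) ^ 2 * card (verts G) ^ (card (verts H) - 1) \<le> card (verts H) ^ 2 * n ^ (card (verts H) - 1)"
      using n(3) by (intro mult_left_mono power_mono) auto
    then have "hom_count H \<sigma> G \<kappa> \<le> emb_count H \<sigma> G \<kappa> + card (verts H) ^ 2 * n ^ (card (verts H) - 1)"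
      using hom_count_le_emb_count[OF fin finG, of \<sigma> \<kappa>] by linarith
    then have h1: "real (hom_count H \<sigma> G \<kappa>) \<le> real (emb_count H \<sigma> G \<kappa>) + real (card (verts H) ^ 2) * real n ^ (card (verts H) - 1)"
      by (metis of_nat_add of_nat_le_iff of_nat_mult of_nat_power)
    have "real (card (verts H) ^ 2) * real n ^ (card (verts H) - 1) \<le> x ^ D / 2 * real n ^ card (verts H)"
    proof (cases "card (verts H)")
      case (Suc m)
      have "x ^ D / 2 * real n1 \<le> x ^ D / 2 * real n"
        using n(1) x by (intro mult_left_mono) auto
      then have "real (card (verts H) ^ 2) * real n ^ m \<le> (x ^ D / 2 * real n) * real n ^ m"
        using n1 by (intro mult_right_mono) auto
      then show ?thesis by (simp add: Suc)
    qed (use x in simp)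
    then have h2: "real (hom_count H \<sigma> G \<kappa>) \<le> x ^ D * real n ^ (v + i)"
      using h1 small unfolding vi by linarith
    have "real (hom_count (trim H) \<sigma> G \<kappa>) * (x * real n) ^ i \<le> real (hom_count H \<sigma> G \<kappa>)"
      unfolding i_def using H finG x host_class_ge[OF n(2)]
      by (intro hom_count_trim_le) auto
    also have "\<dots> \<le> x ^ D * real n ^ (v + i)" by (rule h2)
    also have "\<dots> = (x ^ (C + 1) * real n ^ v) * (x * real n) ^ i"
      by (simp add: D_def power_add power_mult_distrib)
    finally have "real (hom_count (trim H) \<sigma> G \<kappa>) \<le> x ^ (C + 1) * real n ^ v"
      by (rule mult_right_le_imp_le) (use x npos in simp)
    also have "\<dots> \<le> x ^ C * real n ^ v"
      using x by (intro mult_right_mono power_decreasing) auto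
    finally have key: "real (hom_count H' \<sigma>' G \<kappa>) \<le> x ^ C * real n ^ card (verts H')"
      by (simp add: rep v_def)
    have "real (hom_count L \<tau> G \<kappa>) \<le> (if (L, \<tau>) = (H', \<sigma>') then x ^ C else 1) * real n ^ card (verts L)"
      if "simple_graph L" for L :: "nat sgraph" and \<tau>
    proof (cases "(L, \<tau>) = (H', \<sigma>')")
      case False
      have "hom_count L \<tau> G \<kappa> \<le> n ^ card (verts L)"
        using simple_graph_finite[OF that] finG hG(3) by (rule hom_count_le_power)
      then have "real (hom_count L \<tau> G \<kappa>) \<le> real n ^ card (verts L)"
        by (simp flip: of_nat_power)
      then show ?thesis by (simp only: False if_False mult_1)
    qed (use key in simp)
    then show "\<exists>N\<ge>n\<^sub>0. \<exists>G \<kappa>. host x N G \<kappa> \<and>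
        (\<forall>L \<tau>. simple_graph L \<longrightarrow>
          real (hom_count L \<tau> G \<kappa>) \<le> (if (L, \<tau>) = (H', \<sigma>') then x ^ C else 1) * real N ^ card (verts L))"
      using n(1,2) by (intro exI[of _ n] conjI exI[of _ G] exI[of _ \<kappa>] allI impI) simp_all
  qed
  then show "\<exists>\<epsilon>. 0 < \<epsilon> \<and> \<epsilon> < 1 \<and> attains \<epsilon> (\<lambda>K'. if K' = (H', \<sigma>') then \<epsilon> ^ C else 1)"
    using x by blast
qed

end

section \<open>Uniform packings\<close>

context coloured_base
begin

definition uniform_packing :: "real \<Rightarrow> nat sgraph \<Rightarrow> (nat \<Rightarrow> 'c) \<Rightarrow> bool" where
  "uniform_packing \<epsilon> G \<kappa> \<longleftrightarrow>
     simple_graph G \<and> graph_hom G Q \<kappa> \<and>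
     (\<exists>\<C>. packing F \<rho> G \<kappa> \<C> \<and>
       (\<forall>v\<in>verts G. \<epsilon> * real (card (verts G)) \<le> real (card {\<psi> \<in> \<C>. v \<in> \<psi> ` verts F})))"

lemma degrees_le_packing:
  assumes G: "simple_graph G" and p: "packing F \<rho> G \<kappa> \<C>"
    and deg: "\<And>v. v \<in> verts G \<Longrightarrow> t \<le> real (card {\<psi> \<in> \<C>. v \<in> \<psi> ` verts F})"
  shows "real (card (verts G)) * t \<le> real (card (verts F)) * real (card \<C>)"
proof -
  have fin: "finite (verts G)" "finite \<C>"
    using simple_graph_finite[OF G] finite_packing[OF G p] by simp_all
  have "card {v \<in> verts G. v \<in> \<psi> ` verts F} = card (verts F)" if "\<psi> \<in> \<C>" for \<psi>
  proof -
    note e = embeddingsD[OF packing_embedding[OF p that]]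
    have "{v \<in> verts G. v \<in> \<psi> ` verts F} = \<psi> ` verts F" using e(2) by auto
    then show ?thesis using e(4) by (simp add: card_image)
  qed
  then have "(\<Sum>v\<in>verts G. card {\<psi> \<in> \<C>. v \<in> \<psi> ` verts F}) = (\<Sum>\<psi>\<in>\<C>. card (verts F))"
    using fin by (intro sum_multicount_gen) auto
  also have "\<dots> = card (verts F) * card \<C>" by simp
  finally have "real (\<Sum>v\<in>verts G. card {\<psi> \<in> \<C>. v \<in> \<psi> ` verts F}) = real (card (verts F)) * real (card \<C>)"
    by simp
  moreover have "(\<Sum>v\<in>verts G. t) \<le> (\<Sum>v\<in>verts G. real (card {\<psi> \<in> \<C>. v \<in> \<psi> ` verts F}))"
    using deg by (rule sum_mono)
  ultimately show ?thesis by simp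
qed

lemma card_host_le:
  assumes "host \<epsilon> N G \<kappa>"
  shows "card (verts G) \<le> card (verts F) * N"
proof -
  note h = hostD[OF assms]
  have "verts G = (\<Union>q\<in>verts Q. {v \<in> verts G. \<kappa> v = q})" using h(2) by (auto simp: graph_hom_def)
  then have "card (verts G) \<le> (\<Sum>q\<in>verts Q. card {v \<in> verts G. \<kappa> v = q})"
    using card_UN_le[OF finite_Q, of "\<lambda>q. {v \<in> verts G. \<kappa> v = q}"] by simp
  also have "\<dots> \<le> (\<Sum>q\<in>verts Q. N)" using h(3) by (intro sum_mono)
  also have "\<dots> = card (verts Q) * N" by simp
  also have "\<dots> \<le> card (verts F) * N"
    using card_image_le[OF simple_graph_finite[OF simple_F], of \<rho>] by (simp add: surj_\<rho> mult_le_mono1)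
  finally show ?thesis .
qed

text \<open>A host need not be uniform, but it contains a large uniform part: choose \<open>W\<close> to maximise the number of
copies of \<open>F\<close> inside \<open>W\<close> minus \<open>\<tau>\<close> times the size of \<open>W\<close>. Removing a vertex of \<open>W\<close> does not increase
this quantity, so every vertex of \<open>W\<close> lies in at least \<open>\<tau>\<close> of the copies inside \<open>W\<close>. The value of \<open>\<tau>\<close>
is such that the whole vertex set still scores at least \<open>\<epsilon> N\<^sup>2 / 2\<close>, and so does \<open>W\<close>; this makes \<open>W\<close> large.\<close>

lemma uniform_core:
  assumes host: "host \<epsilon> N G \<kappa>" and \<epsilon>: "0 < \<epsilon>"
  obtains G' where "verts G' \<subseteq> verts G" "edges G' \<subseteq> edges G"
    "uniform_packing (\<epsilon> / (2 * real (card (verts F)) ^ 2)) G' \<kappa>" "\<epsilon> / 2 * real N \<le> real (card (verts G'))"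
proof -
  define f where "f = real (card (verts F))"
  have f: "2 \<le> f" using card_F_ge_2 by (simp add: f_def)
  obtain \<C> where \<C>: "packing F \<rho> G \<kappa> \<C>" "\<epsilon> * real N ^ 2 \<le> real (card \<C>)"
    using host by (auto simp: host_def)
  note h = hostD[OF host]
  have finG: "finite (verts G)" and fin\<C>: "finite \<C>"
    using simple_graph_finite[OF h(1)] finite_packing[OF h(1) \<C>(1)] by simp_all
  define \<tau> where "\<tau> = \<epsilon> * real N / (2 * f)"
  define inside where "inside W = {\<psi> \<in> \<C>. \<psi> ` verts F \<subseteq> W}" for W
  define g where "g W = real (card (inside W)) - \<tau> * real (card W)" for W
  define W where "W = arg_min_on (\<lambda>W. - g W) (Pow (verts G))"
  have W: "W \<subseteq> verts G" and gmax: "g W' \<le> g W" if "W' \<subseteq> verts G" for W'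
  proof -
    have "finite (Pow (verts G))" "Pow (verts G) \<noteq> {}" using finG by auto
    note min = arg_min_if_finite[OF this, of "\<lambda>W. - g W"]
    show "W \<subseteq> verts G" using min(1) by (simp add: W_def)
    have "\<not> - g W' < - g W" using min(2) that unfolding W_def by blast
    then show "g W' \<le> g W" by simp
  qed
  have finW: "finite W" using W[OF order_refl] finG by (rule finite_subset)
  have fin_in: "finite (inside X)" for X using fin\<C> by (simp add: inside_def)
  have nfN: "real (card (verts G)) \<le> f * real N"
    using card_host_le[OF host] unfolding f_def by (metis of_nat_le_iff of_nat_mult)
  have "\<tau> * real (card (verts G)) \<le> \<tau> * (f * real N)"
    using nfN \<epsilon> f by (intro mult_left_mono) (auto simp: \<tau>_def)
  also have "\<dots> = \<epsilon> * real N ^ 2 / 2" using f by (simp add: \<tau>_def power2_eq_square)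
  finally have \<tau>G: "\<tau> * real (card (verts G)) \<le> \<epsilon> * real N ^ 2 / 2" .
  have "\<epsilon> * real N ^ 2 / 2 \<le> g (verts G)"
  proof -
    have "inside (verts G) = \<C>"
      using embeddingsD(2)[OF packing_embedding[OF \<C>(1)]] by (auto simp: inside_def)
    then show ?thesis
      using \<tau>G \<C>(2) by (simp add: g_def)
  qed
  also have "\<dots> \<le> g W" by (rule gmax) simp
  also have "\<dots> \<le> real (card (inside W))" using \<epsilon> f by (simp add: g_def \<tau>_def)
  finally have many: "\<epsilon> * real N ^ 2 / 2 \<le> real (card (inside W))" .
  define G' where "G' = SGraph W {e \<in> edges G. e \<subseteq> W}"
  have sub: "verts G' \<subseteq> verts G" "edges G' \<subseteq> edges G" using W by (auto simp: G'_def)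
  have G': "simple_graph G'"
    using h(1) finW by (auto simp: simple_graph_def G'_def)
  have hom': "graph_hom G' Q \<kappa>" using h(2) sub by (auto simp: graph_hom_def)
  have pack: "packing F \<rho> G' \<kappa> (inside W)"
  proof (rule packingI)
    fix \<psi> assume \<psi>: "\<psi> \<in> inside W"
    then have "\<psi> \<in> \<C>" "\<psi> ` verts F \<subseteq> W" by (auto simp: inside_def)
    note e = embeddingsD[OF packing_embedding[OF \<C>(1) \<open>\<psi> \<in> \<C>\<close>]]
    show "\<psi> \<in> embeddings F G'"
    proof (rule embeddingsI)
      show "\<psi> a \<in> verts G'" if "a \<in> verts F" for a
        using that \<open>\<psi> ` verts F \<subseteq> W\<close> by (auto simp: G'_def)
      show "\<psi> ` d \<in> edges G'" if "d \<in> edges F" for d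
      proof -
        have "\<psi> ` d \<subseteq> W" using \<open>\<psi> ` verts F \<subseteq> W\<close> simple_graphD(1)[OF simple_F that] by blast
        then show ?thesis using e(3)[OF that] by (simp add: G'_def)
      qed
    qed (use e in auto)
    show "\<kappa> (\<psi> a) = \<rho> a" if "a \<in> verts F" for a
      using packing_colour[OF \<C>(1) \<open>\<psi> \<in> \<C>\<close> that] .
  next
    fix \<psi> \<chi> e e' assume a: "\<psi> \<in> inside W" "\<chi> \<in> inside W" "e \<in> edges F" "e' \<in> edges F" "\<psi> ` e = \<chi> ` e'"
    have "\<psi> \<in> \<C>" "\<chi> \<in> \<C>" using a by (auto simp: inside_def)
    then show "\<psi> = \<chi>" using packing_edge_eq[OF \<C>(1) _ _ a(3,4,5)] by blast
  qed
  have large: "\<epsilon> / 2 * real N \<le> real (card W)"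
  proof -
    obtain a where "a \<in> verts F" using card_F_ge_2 by fastforce
    then obtain b where b: "{a, b} \<in> edges F" "a \<noteq> b" using edge_at by metis
    have "card (inside W) \<le> card {v \<in> verts G'. \<kappa> v = \<rho> a} * card {v \<in> verts G'. \<kappa> v = \<rho> b}"
      by (rule card_packing_le[OF pack G' b])
    also have "\<dots> \<le> card W * N"
    proof (rule mult_le_mono)
      show "card {v \<in> verts G'. \<kappa> v = \<rho> a} \<le> card W"
        using finW by (intro card_mono) (auto simp: G'_def)
      have "card {v \<in> verts G'. \<kappa> v = \<rho> b} \<le> card {v \<in> verts G. \<kappa> v = \<rho> b}"
        using finG sub by (intro card_mono) auto
      also have "\<dots> \<le> N" by (rule h(3))
      finally show "card {v \<in> verts G'. \<kappa> v = \<rho> b} \<le> N" .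
    qed
    finally have "real (card (inside W)) \<le> real (card W) * real N"
      by (metis of_nat_le_iff of_nat_mult)
    then have "(\<epsilon> / 2 * real N) * real N \<le> real (card W) * real N"
      using many by (simp add: power2_eq_square)
    then show ?thesis by (cases "N = 0") auto
  qed
  have deg: "\<epsilon> / (2 * f ^ 2) * real (card W) \<le> real (card {\<psi> \<in> inside W. v \<in> \<psi> ` verts F})" if v: "v \<in> W" for v
  proof -
    have "inside W \<subseteq> inside (W - {v}) \<union> {\<psi> \<in> inside W. v \<in> \<psi> ` verts F}" by (auto simp: inside_def)
    then have "card (inside W) \<le> card (inside (W - {v}) \<union> {\<psi> \<in> inside W. v \<in> \<psi> ` verts F})"
      using fin_in by (intro card_mono) auto
    also have "\<dots> \<le> card (inside (W - {v})) + card {\<psi> \<in> inside W. v \<in> \<psi> ` verts F}"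
      by (rule card_Un_le)
    finally have 1: "real (card (inside W)) \<le> real (card (inside (W - {v}))) + real (card {\<psi> \<in> inside W. v \<in> \<psi> ` verts F})"
      by linarith
    have cW: "real (card (W - {v})) = real (card W) - 1"
    proof -
      have "card W > 0" using v finW by (auto simp: card_gt_0_iff)
      then show ?thesis using v finW by (simp add: card_Diff_singleton of_nat_diff)
    qed
    have "g (W - {v}) \<le> g W" using W by (intro gmax) auto
    then have 2: "real (card (inside (W - {v}))) - \<tau> * (real (card W) - 1) \<le> real (card (inside W)) - \<tau> * real (card W)"
      unfolding g_def cW .
    have "\<tau> \<le> real (card {\<psi> \<in> inside W. v \<in> \<psi> ` verts F})"
      using 1 2 by (simp add: algebra_simps)
    moreover have "\<epsilon> / (2 * f ^ 2) * real (card W) \<le> \<tau>"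
    proof -
      have "real (card W) \<le> f * real N"
        using nfN card_mono[OF finG W[OF order_refl]] by linarith
      then have "\<epsilon> / (2 * f ^ 2) * real (card W) \<le> \<epsilon> / (2 * f ^ 2) * (f * real N)"
        using \<epsilon> by (intro mult_left_mono) auto
      also have "\<dots> = \<tau>" using f by (simp add: \<tau>_def power2_eq_square)
      finally show ?thesis .
    qed
    ultimately show ?thesis by linarith
  qed
  have "uniform_packing (\<epsilon> / (2 * f ^ 2)) G' \<kappa>"
    unfolding uniform_packing_def using G' hom' pack deg
    by (intro conjI exI[of _ "inside W"]) (auto simp: G'_def)
  then show ?thesis
    using that[OF sub] large by (simp add: f_def G'_def)
qed

lemma uniform_packing_disjoint_copies:
  assumes u: "uniform_packing \<epsilon> G \<kappa>" and m: "m > 0"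
  shows "uniform_packing (\<epsilon> / real m) (disjoint_copies m G) (\<kappa> \<circ> pi2)"
proof -
  let ?P = "disjoint_copies m G"
  obtain \<C> where \<C>: "packing F \<rho> G \<kappa> \<C>"
    "\<forall>v\<in>verts G. \<epsilon> * real (card (verts G)) \<le> real (card {\<psi> \<in> \<C>. v \<in> \<psi> ` verts F})"
    and G: "simple_graph G" "graph_hom G Q \<kappa>"
    using u unfolding uniform_packing_def by (elim conjE exE)
  obtain \<D> where \<D>: "packing F \<rho> ?P (\<kappa> \<circ> pi2) \<D>"
    and deg: "\<forall>n\<in>verts ?P. card {\<psi> \<in> \<C>. pi2 n \<in> \<psi> ` verts F} \<le> card {\<psi> \<in> \<D>. n \<in> \<psi> ` verts F}"
    using packing_disjoint_copies[OF simple_F edges_F \<C>(1) finite_packing[OF G(1) \<C>(1)], of m]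
    by (elim exE conjE)
  have "\<epsilon> / real m * real (card (verts ?P)) \<le> real (card {\<psi> \<in> \<D>. n \<in> \<psi> ` verts F})" if n: "n \<in> verts ?P" for n
  proof -
    have "pi2 n \<in> verts G" using n by (simp add: disjoint_copies_verts)
    then have "\<epsilon> * real (card (verts G)) \<le> real (card {\<psi> \<in> \<C>. pi2 n \<in> \<psi> ` verts F})"
      using \<C>(2) by blast
    also have "\<dots> \<le> real (card {\<psi> \<in> \<D>. n \<in> \<psi> ` verts F})" using deg n by simp
    finally have "\<epsilon> * real (card (verts G)) \<le> real (card {\<psi> \<in> \<D>. n \<in> \<psi> ` verts F})" .
    then show ?thesis using m by (simp add: card_disjoint_copies)
  qed
  then show ?thesis
    unfolding uniform_packing_def
    using simple_graph_disjoint_copies[OF G(1)] graph_hom_disjoint_copies[OF G(2)] \<D>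
    by (intro conjI exI[of _ \<D>] ballI)
qed

section \<open>A host that is sparse for a whole family\<close>

definition small_patterns :: "nat \<Rightarrow> (nat sgraph \<times> (nat \<Rightarrow> 'c)) set" where
  "small_patterns r = {(H, \<sigma>). \<exists>n\<le>r. simple_graph H \<and> verts H = {..<n} \<and> \<sigma> \<in> {..<n} \<rightarrow>\<^sub>E verts Q}"

lemma finite_small_patterns: "finite (small_patterns r)"
proof -
  have "small_patterns r \<subseteq> (\<Union>n\<le>r. (\<lambda>(E, \<sigma>). (SGraph {..<n} E, \<sigma>)) ` (Pow (Pow {..<n}) \<times> ({..<n} \<rightarrow>\<^sub>E verts Q)))"
  proof
    fix K assume "K \<in> small_patterns r"
    then obtain H \<sigma> n where K: "K = (H, \<sigma>)" "n \<le> r" "simple_graph H" "verts H = {..<n}" "\<sigma> \<in> {..<n} \<rightarrow>\<^sub>E verts Q"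
      unfolding small_patterns_def by blast
    have "H = SGraph {..<n} (edges H)" using K(4) by (cases H) simp
    moreover have "edges H \<in> Pow (Pow {..<n})" using simple_graphD(1)[OF K(3)] K(4) by auto
    ultimately have "K \<in> (\<lambda>(E, \<sigma>). (SGraph {..<n} E, \<sigma>)) ` (Pow (Pow {..<n}) \<times> ({..<n} \<rightarrow>\<^sub>E verts Q))"
      using K(1,5) by (intro image_eqI[of _ _ "(edges H, \<sigma>)"]) auto
    then show "K \<in> (\<Union>n\<le>r. (\<lambda>(E, \<sigma>). (SGraph {..<n} E, \<sigma>)) ` (Pow (Pow {..<n}) \<times> ({..<n} \<rightarrow>\<^sub>E verts Q)))"
      using K(2) by blast
  qed
  then show ?thesis
    by (rule finite_subset) (auto intro!: finite_PiE finite_Q)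
qed

text \<open>The consequence of non-abundance that the argument starts from. The constant \<open>b\<close> is the loss incurred
when a far graph is turned into a host.\<close>

definition sparsely_embedded :: "real \<Rightarrow> 'k sgraph \<times> ('k \<Rightarrow> 'c) \<Rightarrow> bool" where
  "sparsely_embedded b = (\<lambda>(H, \<sigma>). \<forall>c C :: real. 0 < c \<and> 0 < C \<longrightarrow> (\<exists>\<epsilon>. 0 < \<epsilon> \<and> \<epsilon> \<le> 1 \<and>
      (\<forall>n\<^sub>0. \<exists>n\<ge>n\<^sub>0. \<exists>G \<kappa>. host (\<epsilon> / b) n G \<kappa> \<and> card (verts G) \<le> n \<and>
         real (emb_count H \<sigma> G \<kappa>) < c * \<epsilon> powr C * real n ^ card (verts H))))"

text \<open>Let \<open>d\<close> be the exponent that beats the target bound. Patterns with at most \<open>r = 2 d\<close> non-isolated vertices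
are suppressed jointly, with exponent \<open>2 d + 2 r\<close>: the part \<open>2 r\<close> compensates for the difference between
\<open>N\<close> and the size of the uniform core, a factor of at most \<open>1/\<epsilon>\<^sup>2\<close> for each vertex, and the part \<open>2 d\<close>
becomes \<open>d\<close> because \<open>\<epsilon>\<^sup>2 \<le> x\<close> for the density \<open>x\<close> of the core. Taking disjoint copies does not increase
homomorphism densities, so these patterns stay sparse. A pattern with more than \<open>2 d\<close> non-isolated
vertices becomes sparse by taking \<open>m \<ge> 1/x\<close> copies, since its density drops to at most \<open>x\<^sup>d\<close>.\<close>

lemma sparse_for_family:
  fixes \<K> :: "('k sgraph \<times> ('k \<Rightarrow> 'c)) set" and c C b :: real
  assumes pat: "\<And>H \<sigma>. (H, \<sigma>) \<in> \<K> \<Longrightarrow> simple_graph H \<and> \<sigma> ` verts H \<subseteq> verts Q"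
    and sparse: "\<And>K. K \<in> \<K> \<Longrightarrow> sparsely_embedded b K" and b: "1 < b"
    and c: "0 < c" and C: "0 < C"
  obtains \<epsilon> where "0 < \<epsilon>" "\<epsilon> \<le> 1"
    "\<And>n\<^sub>0. \<exists>G \<kappa>. uniform_packing \<epsilon> G \<kappa> \<and> n\<^sub>0 \<le> card (verts G) \<and>
      (\<forall>(H, \<sigma>)\<in>\<K>. real (emb_count H \<sigma> G \<kappa>) < c * \<epsilon> powr C * real (card (verts G)) ^ card (verts H))"
proof -
  define f where "f = real (card (verts F))"
  have f: "2 \<le> f" using card_F_ge_2 by (simp add: f_def)
  obtain d :: nat where d:
    "\<forall>x m. 0 < x \<and> x \<le> 1 / 2 \<and> 0 < m \<and> m \<le> 2 / x \<longrightarrow> x ^ d < c * (x / m) powr C"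
    using dominating_exponent[OF c C] by (elim exE)
  define r S where "r = 2 * d" and "S = {K \<in> small_patterns r. suppressible K}"
  have "finite S" using finite_small_patterns by (simp add: S_def)
  moreover have "suppressible K" if "K \<in> S" for K using that by (simp add: S_def)
  ultimately have "\<exists>\<epsilon>. 0 < \<epsilon> \<and> \<epsilon> \<le> 1 / (2 * f ^ 2) \<and>
      attains \<epsilon> (\<lambda>K. if K \<in> S then \<epsilon> ^ (2 * d + 2 * r) else 1)"
    unfolding f_def by (rule jointly_suppressible)
  then obtain \<epsilon> where \<epsilon>: "0 < \<epsilon>" "\<epsilon> \<le> 1 / (2 * f ^ 2)"
    and att: "attains \<epsilon> (\<lambda>K. if K \<in> S then \<epsilon> ^ (2 * d + 2 * r) else 1)"
    by (elim exE conjE)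
  define x where "x = \<epsilon> / (2 * f ^ 2)"
  have "2 ^ 2 \<le> f ^ 2" using f by (intro power_mono) auto
  then have f2: "1 \<le> 2 * f ^ 2" "2 \<le> 2 * f ^ 2" "0 < 2 * f ^ 2" by auto
  have x0: "0 < x" using \<epsilon> f2 by (simp add: x_def)
  have "x \<le> \<epsilon>" using \<epsilon> f2 by (simp add: x_def divide_le_eq mult_le_cancel_left1)
  moreover have eps_half: "\<epsilon> \<le> 1 / 2"
  proof -
    have "1 / (2 * f ^ 2) \<le> 1 / 2" using f2 by (intro divide_left_mono) auto
    then show ?thesis using \<epsilon>(2) by linarith
  qed
  ultimately have x_half: "x \<le> 1 / 2" by simp
  have eps2: "\<epsilon> ^ 2 \<le> x"
    using mult_left_mono[OF \<epsilon>(2), of \<epsilon>] \<epsilon>(1) by (simp add: x_def power2_eq_square)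
  define m where "m = nat \<lceil>1 / x\<rceil>"
  have m_ge: "1 / x \<le> real m" by (simp add: m_def real_nat_ceiling_ge)
  have "0 < 1 / x" using x0 by simp
  then have m0: "0 < m" using m_ge by (cases m) auto
  have "real m \<le> 1 / x + 1"
    using x0 by (simp add: m_def of_nat_ceiling)
  also have "\<dots> \<le> 2 / x" using x0 x_half by (simp add: field_simps)
  finally have m_le: "real m \<le> 2 / x" .
  have xm: "1 \<le> x * real m" using m_ge x0 by (simp add: divide_le_eq mult.commute)
  have bound: "x ^ d < c * (x / real m) powr C"
    using d x0 x_half m_le m0 by simp
  show ?thesis
  proof (rule that[of "x / real m"])
    show "0 < x / real m" using x0 m0 by simp
    have "x \<le> real m" using x_half m0 by linarith
    then show "x / real m \<le> 1" using m0 by simp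
    fix n\<^sub>0
    obtain n1 :: nat where n1: "real (n\<^sub>0 + 1) \<le> \<epsilon> / 2 * real n1"
      using real_arch_simple[of "real (n\<^sub>0 + 1) / (\<epsilon> / 2)"] \<epsilon> by (auto simp: divide_le_eq mult.commute)
    obtain N G \<kappa> where N: "N \<ge> n1" "host \<epsilon> N G \<kappa>"
      and hom: "\<And>H \<sigma>. simple_graph H \<Longrightarrow>
        real (hom_count H \<sigma> G \<kappa>) \<le> (if (H, \<sigma>) \<in> S then \<epsilon> ^ (2 * d + 2 * r) else 1) * real N ^ card (verts H)"
      using att[unfolded attains_def, rule_format, of n1] by blast
    obtain G' where sub: "verts G' \<subseteq> verts G" "edges G' \<subseteq> edges G"
      and u: "uniform_packing x G' \<kappa>" and large: "\<epsilon> / 2 * real N \<le> real (card (verts G'))"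
      using uniform_core[OF N(2) \<epsilon>(1)] unfolding x_def f_def .
    define n' where "n' = card (verts G')"
    define P where "P = disjoint_copies m G'"
    have G': "simple_graph G'" using u by (simp add: uniform_packing_def)
    have finG: "finite (verts G)" using hostD(1)[OF N(2)] by (rule simple_graph_finite)
    have uP: "uniform_packing (x / real m) P (\<kappa> \<circ> pi2)"
      unfolding P_def using u m0 by (rule uniform_packing_disjoint_copies)
    have P: "simple_graph P" using uP by (simp add: uniform_packing_def)
    have cP: "card (verts P) = m * n'" by (simp add: P_def n'_def card_disjoint_copies)
    have "\<epsilon> / 2 * real n1 \<le> \<epsilon> / 2 * real N" using N(1) \<epsilon> by (intro mult_left_mono) auto
    then have "real (n\<^sub>0 + 1) \<le> real n'" using n1 large unfolding n'_def by linarith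
    then have n'0: "n\<^sub>0 + 1 \<le> n'" by linarith
    have "n' \<le> m * n'" using m0 by simp
    then have n0: "n\<^sub>0 \<le> card (verts P)" unfolding cP using n'0 by linarith
    have N2: "\<epsilon> ^ 2 * real N \<le> real n'"
    proof -
      have "\<epsilon> ^ 2 \<le> \<epsilon> / 2" using mult_left_mono[OF eps_half, of \<epsilon>] \<epsilon>(1) by (simp add: power2_eq_square)
      then have "\<epsilon> ^ 2 * real N \<le> \<epsilon> / 2 * real N" by (intro mult_right_mono) auto
      then show ?thesis using large unfolding n'_def by linarith
    qed
    have trimmed: "real (hom_count (trim H) \<sigma> P (\<kappa> \<circ> pi2)) \<le> x ^ d * real (m * n') ^ card (verts (trim H))"
      if K: "(H, \<sigma>) \<in> \<K>" for H \<sigma>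
    proof -
      have H: "simple_graph H" "\<sigma> ` verts H \<subseteq> verts Q" using pat[OF K] by auto
      let ?T = "trim H" and ?v = "card (verts (trim H))"
      have T: "simple_graph ?T" using H(1) by (rule simple_graph_trim)
      have finT: "finite (verts ?T)" using T by (rule simple_graph_finite)
      have cover: "\<exists>e\<in>edges ?T. v \<in> e" if "v \<in> verts ?T" for v
        using that by (simp add: trim_def)
      have "hom_count ?T \<sigma> P (\<kappa> \<circ> pi2) \<le> m ^ (?v div 2) * hom_count ?T \<sigma> G' \<kappa>"
        unfolding P_def by (rule hom_count_disjoint_copies[OF T cover G' m0])
      then have copies: "real (hom_count ?T \<sigma> P (\<kappa> \<circ> pi2)) \<le> real m ^ (?v div 2) * real (hom_count ?T \<sigma> G' \<kappa>)"
        by (metis of_nat_le_iff of_nat_mult of_nat_power)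
      show ?thesis
      proof (cases "?v \<le> r")
        case True
        obtain H' \<sigma>' where H': "simple_graph H'" "verts H' = {..<?v}" "\<sigma>' \<in> {..<?v} \<rightarrow>\<^sub>E \<sigma> ` verts ?T"
          and rep: "\<And>(G :: nat sgraph) \<kappa>. hom_count H' \<sigma>' G \<kappa> = hom_count ?T \<sigma> G \<kappa>"
          using nat_representative[OF T] by blast
        have "suppressible (H', \<sigma>')"
        proof (rule suppressible_trim[OF H b _ _ rep])
          show "\<exists>\<epsilon>. 0 < \<epsilon> \<and> \<epsilon> \<le> 1 \<and>
              (\<forall>n\<^sub>0. \<exists>n\<ge>n\<^sub>0. \<exists>G \<kappa>. host (\<epsilon> / b) n G \<kappa> \<and> card (verts G) \<le> n \<and>
                 real (emb_count H \<sigma> G \<kappa>) < c * \<epsilon> powr C * real n ^ card (verts H))"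
            if "0 < c" "0 < C" for c C :: real
            by (rule sparse[OF K, unfolded sparsely_embedded_def prod.case, rule_format, OF conjI[OF that]])
          show "card (verts H') = card (verts ?T)" by (simp add: H'(2))
        qed
        moreover have "(H', \<sigma>') \<in> small_patterns r"
        proof -
          have "\<sigma> ` verts ?T \<subseteq> verts Q" using H(2) image_mono[OF trim_simps(2)] by (rule order_trans[rotated])
          then have "({..<?v} \<rightarrow>\<^sub>E \<sigma> ` verts ?T) \<subseteq> ({..<?v} \<rightarrow>\<^sub>E verts Q)" by (rule PiE_mono)
          then have "\<sigma>' \<in> {..<?v} \<rightarrow>\<^sub>E verts Q" using H'(3) by (rule subsetD)
          then show ?thesis
            unfolding small_patterns_def mem_Collect_eq prod.case using True H'(1,2)
            by (intro exI[of _ ?v] conjI)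
        qed
        ultimately have "(H', \<sigma>') \<in> S" by (simp add: S_def)
        then have "real (hom_count ?T \<sigma> G \<kappa>) \<le> \<epsilon> ^ (2 * d + 2 * r) * real N ^ ?v"
          using hom[OF H'(1), of \<sigma>'] by (simp add: rep H'(2))
        moreover have "hom_count ?T \<sigma> G' \<kappa> \<le> hom_count ?T \<sigma> G \<kappa>"
          by (rule hom_count_mono[OF finT finG sub])
        ultimately have "real (hom_count ?T \<sigma> G' \<kappa>) \<le> \<epsilon> ^ (2 * d) * (\<epsilon> ^ (2 * r) * real N ^ ?v)"
          by (simp add: power_add)
        also have "\<dots> \<le> \<epsilon> ^ (2 * d) * (\<epsilon> ^ (2 * ?v) * real N ^ ?v)"
          using \<epsilon>(1) eps_half True by (intro mult_left_mono mult_right_mono power_decreasing) auto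
        also have "\<dots> = (\<epsilon> ^ 2) ^ d * (\<epsilon> ^ 2 * real N) ^ ?v"
          by (simp add: power_mult power_mult_distrib)
        also have "\<dots> \<le> x ^ d * real n' ^ ?v"
          using eps2 N2 x0 by (intro mult_mono power_mono) auto
        finally have "real (hom_count ?T \<sigma> G' \<kappa>) \<le> x ^ d * real n' ^ ?v" .
        then have "real (hom_count ?T \<sigma> P (\<kappa> \<circ> pi2)) \<le> real m ^ (?v div 2) * (x ^ d * real n' ^ ?v)"
          using copies by (meson dual_order.trans mult_left_mono zero_le_power of_nat_0_le_iff)
        also have "\<dots> \<le> real m ^ ?v * (x ^ d * real n' ^ ?v)"
          using m0 x0 by (intro mult_right_mono power_increasing) auto
        also have "\<dots> = x ^ d * real (m * n') ^ ?v" by (simp add: power_mult_distrib)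
        finally show ?thesis .
      next
        case False
        have "hom_count ?T \<sigma> G' \<kappa> \<le> n' ^ ?v"
          unfolding n'_def using finT simple_graph_finite[OF G']
          by (intro hom_count_le_power card_mono) auto
        then have "real (hom_count ?T \<sigma> G' \<kappa>) \<le> real n' ^ ?v"
          by (simp flip: of_nat_power)
        then have "real (hom_count ?T \<sigma> P (\<kappa> \<circ> pi2)) \<le> real m ^ (?v div 2) * real n' ^ ?v"
          using copies by (meson dual_order.trans mult_left_mono zero_le_power of_nat_0_le_iff)
        \<comment> \<open>The factor \<open>(x m)\<^sup>d \<ge> 1\<close> is inserted to trade \<open>d\<close> of the unused powers of \<open>m\<close> for powers of \<open>x\<close>.\<close>
        also have "\<dots> \<le> ((x * real m) ^ d * real m ^ (?v div 2)) * real n' ^ ?v"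
          using one_le_power[OF xm, of d] by (intro mult_right_mono) (auto simp: mult_le_cancel_right1)
        also have "\<dots> = x ^ d * real m ^ (d + ?v div 2) * real n' ^ ?v"
          by (simp add: power_mult_distrib power_add)
        also have "\<dots> \<le> x ^ d * real m ^ ?v * real n' ^ ?v"
          using m0 x0 False by (intro mult_right_mono mult_left_mono power_increasing) (auto simp: r_def)
        also have "\<dots> = x ^ d * real (m * n') ^ ?v" by (simp add: power_mult_distrib)
        finally show ?thesis .
      qed
    qed
    have "real (emb_count H \<sigma> P (\<kappa> \<circ> pi2)) < c * (x / real m) powr C * real (card (verts P)) ^ card (verts H)"
      if K: "(H, \<sigma>) \<in> \<K>" for H \<sigma>
    proof -
      have H: "simple_graph H" using pat[OF K] by auto
      have fin: "finite (verts H)" "finite (verts P)" using H P by (auto intro: simple_graph_finite)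
      let ?v = "card (verts (trim H))" and ?i = "card (isolated_verts H)"
      have "emb_count H \<sigma> P (\<kappa> \<circ> pi2) \<le> hom_count (trim H) \<sigma> P (\<kappa> \<circ> pi2) * (m * n') ^ ?i"
        using emb_count_le_hom_count[OF fin, of \<sigma> "\<kappa> \<circ> pi2"] hom_count_le_trim[OF H fin(2), of \<sigma> "\<kappa> \<circ> pi2"]
        unfolding cP by linarith
      then have "real (emb_count H \<sigma> P (\<kappa> \<circ> pi2)) \<le> real (hom_count (trim H) \<sigma> P (\<kappa> \<circ> pi2)) * real (m * n') ^ ?i"
        by (metis of_nat_le_iff of_nat_mult of_nat_power)
      also have "\<dots> \<le> x ^ d * real (m * n') ^ ?v * real (m * n') ^ ?i"
        using trimmed[OF K] by (intro mult_right_mono) auto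
      also have "\<dots> = x ^ d * real (m * n') ^ card (verts H)"
        by (simp add: card_trim_isolated[OF fin(1)] power_add)
      also have "\<dots> < c * (x / real m) powr C * real (m * n') ^ card (verts H)"
        using bound m0 n'0 by (intro mult_strict_right_mono) auto
      finally show ?thesis unfolding cP .
    qed
    then show "\<exists>G \<kappa>. uniform_packing (x / real m) G \<kappa> \<and> n\<^sub>0 \<le> card (verts G) \<and>
      (\<forall>(H, \<sigma>)\<in>\<K>. real (emb_count H \<sigma> G \<kappa>) < c * (x / real m) powr C * real (card (verts G)) ^ card (verts H))"
      using uP n0 by (intro exI[of _ P] exI[of _ "\<kappa> \<circ> pi2"]) auto
  qed
qed

end

section \<open>Distance from freeness and packings\<close>

text \<open>Deleting all edges used by a packing of maximum size destroys all copies of \<open>F\<close>.\<close>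

lemma far_imp_packing:
  fixes G :: "'b sgraph"
  assumes F: "simple_graph F" "edges F \<noteq> {}" and G: "simple_graph G" and far: "far_from_free F \<epsilon> G"
  shows "\<exists>\<C>. packing F (\<lambda>_. ()) G (\<lambda>_. ()) \<C> \<and>
    \<epsilon> * real (card (verts G)) ^ 2 \<le> real (card (edges F)) * real (card \<C>)"
proof -
  let ?pack = "packing F (\<lambda>_. ()) G (\<lambda>_. ())"
  have finE: "finite (embeddings F G)"
    using F G by (intro embeddings_finite simple_graph_finite)
  have "?pack {}" by (simp add: packing_def disjoint_family_on_def)
  moreover have "\<forall>\<C>. ?pack \<C> \<longrightarrow> card \<C> < Suc (card (embeddings F G))"
    using finE by (simp add: packing_def card_mono less_Suc_eq_le)
  ultimately have "\<exists>\<C>. ?pack \<C> \<and> (\<forall>\<D>. ?pack \<D> \<longrightarrow> card \<D> \<le> card \<C>)"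
    by (rule ex_has_greatest_nat)
  then obtain \<C> where \<C>: "?pack \<C>" and max: "\<forall>\<D>. ?pack \<D> \<longrightarrow> card \<D> \<le> card \<C>"
    by (elim exE conjE)
  have "\<C> \<subseteq> embeddings F G" using packing_embedding[OF \<C>] by (rule subsetI)
  then have fin\<C>: "finite \<C>" using finE by (rule finite_subset)
  define D where "D = (\<Union>\<psi>\<in>\<C>. (\<lambda>e. \<psi> ` e) ` edges F)"
  have D: "D \<subseteq> edges G"
    using embeddingsD(3)[OF packing_embedding[OF \<C>]] by (auto simp: D_def)
  have "free_of F (SGraph (verts G) (edges G - D))"
    unfolding free_of_def
  proof (rule equals0I)
    fix \<phi> assume \<phi>: "\<phi> \<in> embeddings F (SGraph (verts G) (edges G - D))"
    note e = embeddingsD[OF \<phi>]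
    have avoid: "\<phi> ` d \<notin> D" if "d \<in> edges F" for d using e(3)[OF that] by simp
    have emb: "\<phi> \<in> embeddings F G"
      using e by (intro embeddingsI) auto
    have clash: "\<phi> ` d \<noteq> \<psi> ` d'" if "\<psi> \<in> \<C>" "d \<in> edges F" "d' \<in> edges F" for \<psi> d d'
      using avoid[OF that(2)] that(1,3) by (auto simp: D_def)
    obtain d where d: "d \<in> edges F" using F(2) by auto
    have "\<phi> \<notin> \<C>" using clash[OF _ d d] by blast
    have "?pack (insert \<phi> \<C>)"
    proof (rule packingI)
      show "\<psi> \<in> embeddings F G" if "\<psi> \<in> insert \<phi> \<C>" for \<psi>
        using that emb packing_embedding[OF \<C>] by (elim insertE) simp_all
      fix \<psi> \<chi> d d' assume a: "\<psi> \<in> insert \<phi> \<C>" "\<chi> \<in> insert \<phi> \<C>" "d \<in> edges F" "d' \<in> edges F" "\<psi> ` d = \<chi> ` d'"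
      show "\<psi> = \<chi>"
      proof (cases "\<psi> = \<phi>"; cases "\<chi> = \<phi>")
        assume "\<psi> = \<phi>" "\<chi> \<noteq> \<phi>"
        then show ?thesis using clash[of \<chi> d d'] a by simp
      next
        assume "\<psi> \<noteq> \<phi>" "\<chi> = \<phi>"
        then show ?thesis using clash[of \<psi> d' d] a by simp
      next
        assume "\<psi> \<noteq> \<phi>" "\<chi> \<noteq> \<phi>"
        then show ?thesis using packing_edge_eq[OF \<C> _ _ a(3,4,5)] a(1,2) by simp
      qed simp
    qed simp
    then have "card (insert \<phi> \<C>) \<le> card \<C>" using max by blast
    then show False using \<open>\<phi> \<notin> \<C>\<close> fin\<C> by simp
  qed
  then have "\<epsilon> * real (card (verts G)) ^ 2 \<le> real (card D)"
    using far D by (simp add: far_from_free_def)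
  also have "card D \<le> (\<Sum>\<psi>\<in>\<C>. card ((\<lambda>e. \<psi> ` e) ` edges F))"
    unfolding D_def using fin\<C> by (rule card_UN_le)
  also have "\<dots> \<le> (\<Sum>\<psi>\<in>\<C>. card (edges F))"
    using simple_graph_finite_edges[OF F(1)] by (intro sum_mono card_image_le)
  also have "\<dots> = card (edges F) * card \<C>" by simp
  finally have "\<epsilon> * real (card (verts G)) ^ 2 \<le> real (card (edges F)) * real (card \<C>)" by simp
  then show ?thesis using \<C> by blast
qed

text \<open>Every copy in a packing must lose an edge, and these edges are distinct.\<close>

lemma packing_imp_far:
  assumes G: "simple_graph G" and p: "packing F \<rho> G \<kappa> \<C>"
    and large: "\<epsilon> * real (card (verts G)) ^ 2 \<le> real (card \<C>)"
  shows "far_from_free F \<epsilon> G"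
  unfolding far_from_free_def
proof (intro allI impI)
  fix D assume D: "D \<subseteq> edges G" and free: "free_of F (SGraph (verts G) (edges G - D))"
  have "\<exists>e\<in>edges F. \<psi> ` e \<in> D" if \<psi>: "\<psi> \<in> \<C>" for \<psi>
  proof (rule ccontr)
    assume no: "\<not> (\<exists>e\<in>edges F. \<psi> ` e \<in> D)"
    note e = embeddingsD[OF packing_embedding[OF p \<psi>]]
    have "\<psi> \<in> embeddings F (SGraph (verts G) (edges G - D))"
      using e no by (intro embeddingsI) auto
    then show False using free by (simp add: free_of_def)
  qed
  then obtain t where t: "\<forall>\<psi>\<in>\<C>. t \<psi> \<in> edges F \<and> \<psi> ` t \<psi> \<in> D" by metis
  have "inj_on (\<lambda>\<psi>. \<psi> ` t \<psi>) \<C>"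
  proof (rule inj_onI)
    fix \<psi> \<chi> assume a: "\<psi> \<in> \<C>" "\<chi> \<in> \<C>" "\<psi> ` t \<psi> = \<chi> ` t \<chi>"
    then show "\<psi> = \<chi>" using packing_edge_eq[OF p a(1,2) _ _ a(3)] t by blast
  qed
  moreover have "(\<lambda>\<psi>. \<psi> ` t \<psi>) ` \<C> \<subseteq> D" using t by blast
  moreover have "finite D" using D simple_graph_finite_edges[OF G] by (rule finite_subset)
  ultimately have "card \<C> \<le> card D" by (rule card_inj_on_le)
  then show "\<epsilon> * real (card (verts G)) ^ 2 \<le> real (card D)" using large by linarith
qed

section \<open>Abundant families\<close>

lemma (in coloured_base) uniform_packing_host:
  assumes "uniform_packing \<epsilon> G \<kappa>"
  shows "host (\<epsilon> / real (card (verts F))) (card (verts G)) G \<kappa>"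
proof -
  obtain \<C> where \<C>: "packing F \<rho> G \<kappa> \<C>"
    "\<forall>v\<in>verts G. \<epsilon> * real (card (verts G)) \<le> real (card {\<psi> \<in> \<C>. v \<in> \<psi> ` verts F})"
    and G: "simple_graph G" "graph_hom G Q \<kappa>"
    using assms unfolding uniform_packing_def by (elim conjE exE)
  have "real (card (verts G)) * (\<epsilon> * real (card (verts G))) \<le> real (card (verts F)) * real (card \<C>)"
    using \<C>(2) by (intro degrees_le_packing[OF G(1) \<C>(1)]) blast
  then have "\<epsilon> / real (card (verts F)) * real (card (verts G)) ^ 2 \<le> real (card \<C>)"
    using card_F_ge_2 by (simp add: divide_le_eq power2_eq_square mult_ac)
  moreover have "card {v \<in> verts G. \<kappa> v = q} \<le> card (verts G)" for q
    using simple_graph_finite[OF G(1)] by (intro card_mono) auto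
  ultimately show ?thesis
    unfolding host_def using G \<C>(1) by (intro conjI allI exI[of _ \<C>])
qed

lemma graph_hom_looped_point:
  assumes "simple_graph G"
  shows "graph_hom G (SGraph {()} {{()}}) (\<lambda>_. ())"
  unfolding graph_hom_def
proof (intro conjI ballI)
  fix e assume "e \<in> edges G"
  then have "e \<noteq> {}" using simple_graphD(2)[OF assms] by fastforce
  then show "(\<lambda>_. ()) ` e \<in> edges (SGraph {()} {{()}})" by auto
qed simp

lemma not_abundant_colE:
  fixes c C :: real
  assumes no: "\<not> abundant_col F (H, \<sigma>)" and pos: "0 < c" "0 < C"
  obtains \<epsilon> where "0 < \<epsilon>" "\<epsilon> \<le> 1"
    "\<forall>n\<^sub>0. \<exists>n\<ge>n\<^sub>0. \<exists>(G :: nat sgraph) \<kappa>. coloured_graph F (G, \<kappa>) \<and> card (verts G) = n \<and>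
       uniformly_far F \<epsilon> G \<kappa> \<and> \<not> real (Emb_col H \<sigma> G \<kappa>) \<ge> c * \<epsilon> powr C * real n ^ card (verts H)"
proof -
  have "\<not> (\<forall>\<epsilon>. 0 < \<epsilon> \<and> \<epsilon> \<le> 1 \<longrightarrow>
         (\<exists>n\<^sub>0::nat. \<forall>n\<ge>n\<^sub>0. \<forall>(G :: nat sgraph) \<kappa>.
            coloured_graph F (G, \<kappa>) \<and> card (verts G) = n \<and> uniformly_far F \<epsilon> G \<kappa> \<longrightarrow>
            real (Emb_col H \<sigma> G \<kappa>) \<ge> c * \<epsilon> powr C * real n ^ card (verts H)))" (is "\<not> ?A")
  proof
    assume ?A
    with pos have "abundant_col F (H, \<sigma>)"
      unfolding abundant_col_def prod.case by (intro exI[of _ c] exI[of _ C] conjI)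
    with no show False ..
  qed
  then show ?thesis
    unfolding not_all not_imp not_ex conj_assoc by (elim exE conjE) (rule that)
qed

lemma not_abundantE:
  fixes c C :: real
  assumes no: "\<not> abundant F H" and pos: "0 < c" "0 < C"
  obtains \<epsilon> where "0 < \<epsilon>" "\<epsilon> \<le> 1"
    "\<forall>n\<^sub>0. \<exists>n\<ge>n\<^sub>0. \<exists>G :: nat sgraph. simple_graph G \<and> card (verts G) = n \<and>
       far_from_free F \<epsilon> G \<and> \<not> real (Emb H G) \<ge> c * \<epsilon> powr C * real n ^ card (verts H)"
proof -
  have "\<not> (\<forall>\<epsilon>. 0 < \<epsilon> \<and> \<epsilon> \<le> 1 \<longrightarrow>
         (\<exists>n\<^sub>0::nat. \<forall>n\<ge>n\<^sub>0. \<forall>G :: nat sgraph.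
            simple_graph G \<and> card (verts G) = n \<and> far_from_free F \<epsilon> G \<longrightarrow>
            real (Emb H G) \<ge> c * \<epsilon> powr C * real n ^ card (verts H)))" (is "\<not> ?A")
  proof
    assume ?A
    with pos have "abundant F H"
      unfolding abundant_def by (intro exI[of _ c] exI[of _ C] conjI)
    with no show False ..
  qed
  then show ?thesis
    unfolding not_all not_imp not_ex conj_assoc by (elim exE conjE) (rule that)
qed

lemma coloured_family_iff:
  fixes F :: "'f sgraph" and \<K> :: "('k sgraph \<times> ('k \<Rightarrow> 'f)) set"
  assumes base: "coloured_base F F (\<lambda>a. a)" and \<K>: "\<forall>K\<in>\<K>. coloured_graph F K"
  shows "abundant_family_col F \<K> \<longleftrightarrow> (\<exists>K\<in>\<K>. abundant_col F K)"
proof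
  assume "\<exists>K\<in>\<K>. abundant_col F K"
  then show "abundant_family_col F \<K>"
    unfolding abundant_family_col_def abundant_col_def by fast
next
  interpret coloured_base F F "\<lambda>a. a" by (rule base)
  have uniform: "coloured_graph F (G, \<kappa>) \<and> uniformly_far F \<epsilon> G \<kappa> \<longleftrightarrow> uniform_packing \<epsilon> G \<kappa>"
    for \<epsilon> and G :: "nat sgraph" and \<kappa>
    unfolding coloured_graph_def uniformly_far_def uniform_packing_def packing_def prod.case by (simp only: conj_assoc)
  assume fam: "abundant_family_col F \<K>"
  show "\<exists>K\<in>\<K>. abundant_col F K"
  proof (rule ccontr)
    assume no: "\<not> (\<exists>K\<in>\<K>. abundant_col F K)"
    obtain c C :: real where cC: "c > 0" "C > 0"
      and ab: "\<forall>\<epsilon>. 0 < \<epsilon> \<and> \<epsilon> \<le> 1 \<longrightarrow>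
         (\<exists>n\<^sub>0::nat. \<forall>n\<ge>n\<^sub>0. \<forall>(G :: nat sgraph) \<kappa>.
            coloured_graph F (G, \<kappa>) \<and> card (verts G) = n \<and> uniformly_far F \<epsilon> G \<kappa> \<longrightarrow>
            (\<exists>(H, \<sigma>)\<in>\<K>. real (Emb_col H \<sigma> G \<kappa>) \<ge> c * \<epsilon> powr C * real n ^ card (verts H)))"
      using fam unfolding abundant_family_col_def by blast
    have sparse: "sparsely_embedded (real (card (verts F))) K" if K: "K \<in> \<K>" for K
      unfolding sparsely_embedded_def
    proof (cases K, simp only: prod.case, intro allI impI)
      fix H \<sigma> and c C :: real assume HK: "K = (H, \<sigma>)" and pos: "0 < c \<and> 0 < C"
      have "\<not> abundant_col F (H, \<sigma>)" using no K HK by blast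
      then obtain \<epsilon> where \<epsilon>: "0 < \<epsilon>" "\<epsilon> \<le> 1"
        and G: "\<forall>n\<^sub>0. \<exists>n\<ge>n\<^sub>0. \<exists>(G :: nat sgraph) \<kappa>. coloured_graph F (G, \<kappa>) \<and> card (verts G) = n \<and>
            uniformly_far F \<epsilon> G \<kappa> \<and> \<not> real (Emb_col H \<sigma> G \<kappa>) \<ge> c * \<epsilon> powr C * real n ^ card (verts H)"
        using not_abundant_colE pos by metis
      have "\<exists>n\<ge>n\<^sub>0. \<exists>G \<kappa>. host (\<epsilon> / real (card (verts F))) n G \<kappa> \<and> card (verts G) \<le> n \<and>
          real (emb_count H \<sigma> G \<kappa>) < c * \<epsilon> powr C * real n ^ card (verts H)" for n\<^sub>0
      proof -
        obtain n and G :: "nat sgraph" and \<kappa> where n: "n \<ge> n\<^sub>0" "card (verts G) = n"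
          and u: "coloured_graph F (G, \<kappa>)" "uniformly_far F \<epsilon> G \<kappa>"
          and less: "\<not> real (Emb_col H \<sigma> G \<kappa>) \<ge> c * \<epsilon> powr C * real n ^ card (verts H)"
          using G by blast
        have "host (\<epsilon> / real (card (verts F))) n G \<kappa>"
          using uniform_packing_host[of \<epsilon> G \<kappa>] u uniform n(2) by blast
        then show ?thesis
          using n less by (intro exI[of _ n] exI[of _ G] exI[of _ \<kappa>] conjI) (simp_all add: Emb_col_eq_emb_count)
      qed
      then show "\<exists>\<epsilon>. 0 < \<epsilon> \<and> \<epsilon> \<le> 1 \<and> (\<forall>n\<^sub>0. \<exists>n\<ge>n\<^sub>0. \<exists>G \<kappa>.
          host (\<epsilon> / real (card (verts F))) n G \<kappa> \<and> card (verts G) \<le> n \<and>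
          real (emb_count H \<sigma> G \<kappa>) < c * \<epsilon> powr C * real n ^ card (verts H))"
        using \<epsilon> by (intro exI[of _ \<epsilon>] conjI allI)
    qed
    have pat: "simple_graph H \<and> \<sigma> ` verts H \<subseteq> verts F" if "(H, \<sigma>) \<in> \<K>" for H \<sigma>
      using \<K> that by (fastforce simp: coloured_graph_def graph_hom_def)
    have "1 < real (card (verts F))" using card_F_ge_2 by simp
    from sparse_for_family[OF pat sparse this cC] obtain \<epsilon> where \<epsilon>: "0 < \<epsilon>" "\<epsilon> \<le> 1"
      and few: "\<And>n\<^sub>0. \<exists>G \<kappa>. uniform_packing \<epsilon> G \<kappa> \<and> n\<^sub>0 \<le> card (verts G) \<and>
        (\<forall>(H, \<sigma>)\<in>\<K>. real (emb_count H \<sigma> G \<kappa>) < c * \<epsilon> powr C * real (card (verts G)) ^ card (verts H))"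
      by blast
    obtain n\<^sub>0 where n\<^sub>0: "\<forall>n\<ge>n\<^sub>0. \<forall>(G :: nat sgraph) \<kappa>.
            coloured_graph F (G, \<kappa>) \<and> card (verts G) = n \<and> uniformly_far F \<epsilon> G \<kappa> \<longrightarrow>
            (\<exists>(H, \<sigma>)\<in>\<K>. real (Emb_col H \<sigma> G \<kappa>) \<ge> c * \<epsilon> powr C * real n ^ card (verts H))"
      using ab \<epsilon> by blast
    obtain G \<kappa> where G: "uniform_packing \<epsilon> G \<kappa>" "n\<^sub>0 \<le> card (verts G)"
      and less: "\<forall>(H, \<sigma>)\<in>\<K>. real (emb_count H \<sigma> G \<kappa>) < c * \<epsilon> powr C * real (card (verts G)) ^ card (verts H)"
      using few[of n\<^sub>0] by blast
    have "\<exists>(H, \<sigma>)\<in>\<K>. real (Emb_col H \<sigma> G \<kappa>) \<ge> c * \<epsilon> powr C * real (card (verts G)) ^ card (verts H)"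
      using n\<^sub>0 G uniform by blast
    then show False using less by (force simp: Emb_col_eq_emb_count)
  qed
qed

text \<open>The graphs found for the family are uniformly packed, and passing from that to distance from
\<open>F\<close>-freeness divides the density by the number \<open>f\<close> of vertices of \<open>F\<close>. The constant \<open>c\<close> is therefore
replaced by \<open>c / f\<^sup>C\<close> beforehand.\<close>

lemma uncoloured_family_iff:
  fixes F :: "'f sgraph" and \<H> :: "'h sgraph set"
  assumes base: "coloured_base F (SGraph {()} {{()}}) (\<lambda>_. ())" and \<H>: "\<forall>H\<in>\<H>. simple_graph H"
  shows "abundant_family F \<H> \<longleftrightarrow> (\<exists>H\<in>\<H>. abundant F H)"
proof
  assume "\<exists>H\<in>\<H>. abundant F H"
  then show "abundant_family F \<H>"
    unfolding abundant_family_def abundant_def by fast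
next
  interpret coloured_base F "SGraph {()} {{()}}" "\<lambda>_. ()" by (rule base)
  define f where "f = real (card (verts F))"
  define b where "b = real (card (edges F) + 1)"
  have f: "2 \<le> f" using card_F_ge_2 by (simp add: f_def)
  have "card (edges F) > 0"
    using edges_F simple_graph_finite_edges[OF simple_F] by (simp add: card_gt_0_iff)
  then have b: "1 < b" by (simp add: b_def)
  have unit: "\<kappa> = (\<lambda>_. ())" for \<kappa> :: "'z \<Rightarrow> unit" by auto
  assume fam: "abundant_family F \<H>"
  show "\<exists>H\<in>\<H>. abundant F H"
  proof (rule ccontr)
    assume no: "\<not> (\<exists>H\<in>\<H>. abundant F H)"
    obtain c C :: real where cC: "c > 0" "C > 0"
      and ab: "\<forall>\<epsilon>. 0 < \<epsilon> \<and> \<epsilon> \<le> 1 \<longrightarrow>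
         (\<exists>n\<^sub>0::nat. \<forall>n\<ge>n\<^sub>0. \<forall>G :: nat sgraph.
            simple_graph G \<and> card (verts G) = n \<and> far_from_free F \<epsilon> G \<longrightarrow>
            (\<exists>H\<in>\<H>. real (Emb H G) \<ge> c * \<epsilon> powr C * real n ^ card (verts H)))"
      using fam unfolding abundant_family_def by blast
    define \<K> where "\<K> = (\<lambda>H. (H, \<lambda>_ :: 'h. ())) ` \<H>"
    have sparse: "sparsely_embedded b K" if K: "K \<in> \<K>" for K
    proof -
      obtain H where HK: "H \<in> \<H>" "K = (H, \<lambda>_. ())" using K by (auto simp: \<K>_def)
      show ?thesis
        unfolding sparsely_embedded_def HK(2) prod.case
      proof (intro allI impI)
        fix c C :: real assume pos: "0 < c \<and> 0 < C"
        have "\<not> abundant F H" using no HK by blast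
        then obtain \<epsilon> where \<epsilon>: "0 < \<epsilon>" "\<epsilon> \<le> 1"
          and G: "\<forall>n\<^sub>0. \<exists>n\<ge>n\<^sub>0. \<exists>G :: nat sgraph. simple_graph G \<and> card (verts G) = n \<and>
              far_from_free F \<epsilon> G \<and> \<not> real (Emb H G) \<ge> c * \<epsilon> powr C * real n ^ card (verts H)"
          using not_abundantE pos by metis
        have "\<exists>n\<ge>n\<^sub>0. \<exists>G \<kappa>. host (\<epsilon> / b) n G \<kappa> \<and> card (verts G) \<le> n \<and>
            real (emb_count H (\<lambda>_. ()) G \<kappa>) < c * \<epsilon> powr C * real n ^ card (verts H)" for n\<^sub>0
        proof -
          obtain n and G :: "nat sgraph" where n: "n \<ge> n\<^sub>0" "card (verts G) = n"
            and u: "simple_graph G" "far_from_free F \<epsilon> G"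
            and less: "\<not> real (Emb H G) \<ge> c * \<epsilon> powr C * real n ^ card (verts H)"
            using G by blast
          obtain \<C> where \<C>: "packing F (\<lambda>_. ()) G (\<lambda>_. ()) \<C>"
            "\<epsilon> * real n ^ 2 \<le> real (card (edges F)) * real (card \<C>)"
            using far_imp_packing[OF simple_F edges_F u] n(2) by blast
          have "real (card (edges F)) * real (card \<C>) \<le> b * real (card \<C>)"
            by (simp add: b_def mult_right_mono)
          then have "\<epsilon> / b * real n ^ 2 \<le> real (card \<C>)"
            using \<C>(2) b by (simp add: divide_le_eq mult.commute)
          moreover have "graph_hom G (SGraph {()} {{()}}) (\<lambda>_. ())"
            using u(1) by (rule graph_hom_looped_point)
          moreover have "card {v \<in> verts G. () = q} \<le> n" for q
            using simple_graph_finite[OF u(1)] n(2) by (metis (lifting) card_mono mem_Collect_eq subsetI)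
          ultimately have "host (\<epsilon> / b) n G (\<lambda>_. ())"
            unfolding host_def using u(1) \<C>(1) by (intro conjI allI exI[of _ \<C>])
          then show ?thesis
            using n less by (intro exI[of _ n] exI[of _ G] exI[of _ "\<lambda>_. ()"] conjI) (simp_all add: Emb_eq_emb_count)
        qed
        then show "\<exists>\<epsilon>. 0 < \<epsilon> \<and> \<epsilon> \<le> 1 \<and> (\<forall>n\<^sub>0. \<exists>n\<ge>n\<^sub>0. \<exists>G \<kappa>.
            host (\<epsilon> / b) n G \<kappa> \<and> card (verts G) \<le> n \<and>
            real (emb_count H (\<lambda>_. ()) G \<kappa>) < c * \<epsilon> powr C * real n ^ card (verts H))"
          using \<epsilon> by (intro exI[of _ \<epsilon>] conjI allI)
      qed
    qed
    have pat: "simple_graph H \<and> \<sigma> ` verts H \<subseteq> verts (SGraph {()} {{()}})" if "(H, \<sigma>) \<in> \<K>" for H \<sigma>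
      using \<H> that by (auto simp: \<K>_def)
    have c': "0 < c / f powr C" using cC f by simp
    from sparse_for_family[OF pat sparse b c' cC(2)] obtain \<epsilon> where \<epsilon>: "0 < \<epsilon>" "\<epsilon> \<le> 1"
      and few: "\<And>n\<^sub>0. \<exists>G \<kappa>. uniform_packing \<epsilon> G \<kappa> \<and> n\<^sub>0 \<le> card (verts G) \<and>
        (\<forall>(H, \<sigma>)\<in>\<K>. real (emb_count H \<sigma> G \<kappa>) < c / f powr C * \<epsilon> powr C * real (card (verts G)) ^ card (verts H))"
      by blast
    have scale: "c / f powr C * \<epsilon> powr C = c * (\<epsilon> / f) powr C"
      using \<epsilon> f by (simp add: powr_divide)
    have "0 < \<epsilon> / f" "\<epsilon> / f \<le> 1" using \<epsilon> f by (simp_all add: divide_le_eq)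
    then obtain n\<^sub>0 where n\<^sub>0: "\<forall>n\<ge>n\<^sub>0. \<forall>G :: nat sgraph.
            simple_graph G \<and> card (verts G) = n \<and> far_from_free F (\<epsilon> / f) G \<longrightarrow>
            (\<exists>H\<in>\<H>. real (Emb H G) \<ge> c * (\<epsilon> / f) powr C * real n ^ card (verts H))"
      using ab by blast
    obtain G \<kappa> where G: "uniform_packing \<epsilon> G \<kappa>" "n\<^sub>0 \<le> card (verts G)"
      and less: "\<forall>(H, \<sigma>)\<in>\<K>. real (emb_count H \<sigma> G \<kappa>) < c / f powr C * \<epsilon> powr C * real (card (verts G)) ^ card (verts H)"
      using few[of n\<^sub>0] by blast
    have simp_G: "simple_graph G" using G(1) by (simp add: uniform_packing_def)
    obtain \<C> where \<C>: "packing F (\<lambda>_. ()) G \<kappa> \<C>" "\<epsilon> / f * real (card (verts G)) ^ 2 \<le> real (card \<C>)"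
      using uniform_packing_host[OF G(1)] unfolding host_def f_def by blast
    have "far_from_free F (\<epsilon> / f) G" by (rule packing_imp_far[OF simp_G \<C>])
    then obtain H where H: "H \<in> \<H>" "real (Emb H G) \<ge> c * (\<epsilon> / f) powr C * real (card (verts G)) ^ card (verts H)"
      using n\<^sub>0 G(2) simp_G by blast
    have "(H, \<lambda>_. ()) \<in> \<K>" using H(1) by (simp add: \<K>_def)
    then have "real (emb_count H (\<lambda>_. ()) G \<kappa>) < c * (\<epsilon> / f) powr C * real (card (verts G)) ^ card (verts H)"
      using less unfolding scale by blast
    then show False using H(2) unfolding Emb_eq_emb_count unit[of \<kappa>] by simp
  qed
qed

theorem corollary1p4:
  fixes F :: "'f sgraph"
  assumes "simple_graph F"
    and "card (edges F) > 0"
    and "\<not> (\<exists>v. isolated F v)"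
  shows "(\<forall>\<K> :: ('k sgraph \<times> ('k \<Rightarrow> 'f)) set. (\<forall>K\<in>\<K>. coloured_graph F K) \<longrightarrow>
           (abundant_family_col F \<K> \<longleftrightarrow> (\<exists>K\<in>\<K>. abundant_col F K)))
       \<and> (\<forall>\<H> :: 'h sgraph set. (\<forall>H\<in>\<H>. simple_graph H) \<longrightarrow>
           (abundant_family F \<H> \<longleftrightarrow> (\<exists>H\<in>\<H>. abundant F H)))"
proof -
  have ne: "edges F \<noteq> {}" using assms(2) by auto
  have cover: "\<exists>e\<in>edges F. a \<in> e" if "a \<in> verts F" for a
    using assms(3) that by (auto simp: isolated_def)
  have "coloured_base F F (\<lambda>a. a)"
    by unfold_locales (use assms(1) ne cover in \<open>auto simp: graph_hom_def\<close>)
  moreover have "coloured_base F (SGraph {()} {{()}}) (\<lambda>_. ())"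
  proof unfold_locales
    show "graph_hom F (SGraph {()} {{()}}) (\<lambda>_. ())"
      using assms(1) by (rule graph_hom_looped_point)
    obtain e where "e \<in> edges F" using ne by auto
    then have "verts F \<noteq> {}" using simple_graphD[OF assms(1)] by fastforce
    then show "(\<lambda>_. ()) ` verts F = verts (SGraph {()} {{()}})" by auto
  qed (use assms(1) ne cover in auto)
  ultimately show ?thesis
    using coloured_family_iff uncoloured_family_iff by blast
qed

end
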